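(* Let $d,N\ge 1$ be integers, let $\vec M_1,\dots,\vec M_N\in\mathbb{Z}^d$ be pairwise distinct, and let $Q=\bigcup_{p=1}^N (Q_0+\vec M_p)$ with $Q_0=[-\tfrac12,\tfrac12)^d$. Let $\vec\delta\in\mathbb{R}^d$ and let $$\mathcal{S}(\vec\delta)=\bigcup_{j=1}^N\{e^{2\pi i\langle\vec n+(j-1)\vec\delta,\,x\rangle}\}_{\vec n\in\mathbb{Z}^d}.$$ Then $\mathcal{S}(\vec\delta)$ is a Riesz basis of $L^2(Q)$ if and only if $\langle\vec M_p-\vec M_q,\vec\delta\rangle\notin\mathbb{Z}$ for every $1\le p\ne q\le N$. In that case, the optimal frame constants of $\mathcal{S}(\vec\delta)$ are the maximum (upper constant) and minimum (lower constant) eigenvalues of the matrix $\widetilde{\mathbf{B}}=\{\tilde\beta_{p,q}\}_{1\le p,q\le N}$, where $$\tilde\beta_{p,q}=\frac{\sin(\pi N\langle\vec\delta,\vec M_q-\vec M_p\rangle)}{\sin(\pi\langle\vec\delta,\vec M_q-\vec M_p\rangle)}\ \text{ if }p\ne q,\qquad \tilde\beta_{p,p}=N.$$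
   Context: The set $\mathcal{S}(\vec\delta)$ is regarded as a family indexed by $(j,\vec n)\in\{1,\dots,N\}\times\mathbb{Z}^d$ of functions of $x$ restricted to $Q$. A countable family $\{v_k\}$ in a separable Hilbert space $H$ is a frame if there are $A,B>0$ with $A\|w\|^2\le\sum_k|\langle w,v_k\rangle|^2\le B\|w\|^2$ for all $w\in H$; it is a Riesz sequence if there are $A,B>0$ with $A\sum_{k\in J}|a_k|^2\le\|\sum_{k\in J}a_kv_k\|^2\le B\sum_{k\in J}|a_k|^2$ for all finite families $\{a_k\}_{k\in J}$ of complex numbers; it is a Riesz basis if it is both. The optimal frame constants are the largest $A$ and smallest $B$ for which the frame inequality holds. *)

theory Defs
  imports "HOL-Analysis.Analysis" "Jordan_Normal_Form.Spectral_Radius"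
begin

section \<open>Frames and Riesz bases of \<open>L\<^sup>2(\<mu>)\<close>\<close>

text \<open>
  Elements of \<open>L\<^sup>2(\<mu>)\<close> are represented by square-integrable functions, without passing to
  classes modulo equality almost everywhere: everything below depends on the functions only
  through integrals over \<open>\<mu>\<close>, so it is invariant under changes on null sets.
\<close>

definition square_integrable :: "'a measure \<Rightarrow> ('a \<Rightarrow> complex) set" where
  "square_integrable \<mu> = {f. f \<in> borel_measurable \<mu> \<and> integrable \<mu> (\<lambda>x. (cmod (f x))\<^sup>2)}"

definition L2_inner :: "'a measure \<Rightarrow> ('a \<Rightarrow> complex) \<Rightarrow> ('a \<Rightarrow> complex) \<Rightarrow> complex" where
  "L2_inner \<mu> f g = (LINT x|\<mu>. f x * cnj (g x))"

definition L2_norm :: "'a measure \<Rightarrow> ('a \<Rightarrow> complex) \<Rightarrow> real" where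
  "L2_norm \<mu> f = sqrt (LINT x|\<mu>. (cmod (f x))\<^sup>2)"

text \<open>
  A family in \<open>L\<^sup>2(\<mu>)\<close> is a function \<open>v\<close> on an index set \<open>K\<close>. Convergence of the frame series is
  stated explicitly, since \<open>infsum\<close> is \<open>0\<close> for families that are not summable.
\<close>

definition frame_bounds ::
    "'a measure \<Rightarrow> 'k set \<Rightarrow> ('k \<Rightarrow> 'a \<Rightarrow> complex) \<Rightarrow> real \<Rightarrow> real \<Rightarrow> bool" where
  "frame_bounds \<mu> K v A B \<longleftrightarrow> A > 0 \<and> B > 0 \<and>
     (\<forall>w\<in>square_integrable \<mu>.
        (\<lambda>k. (cmod (L2_inner \<mu> w (v k)))\<^sup>2) summable_on K \<and>
        A * (L2_norm \<mu> w)\<^sup>2 \<le> (\<Sum>\<^sub>\<infinity>k\<in>K. (cmod (L2_inner \<mu> w (v k)))\<^sup>2) \<and>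
        (\<Sum>\<^sub>\<infinity>k\<in>K. (cmod (L2_inner \<mu> w (v k)))\<^sup>2) \<le> B * (L2_norm \<mu> w)\<^sup>2)"

definition is_frame :: "'a measure \<Rightarrow> 'k set \<Rightarrow> ('k \<Rightarrow> 'a \<Rightarrow> complex) \<Rightarrow> bool" where
  "is_frame \<mu> K v \<longleftrightarrow> countable K \<and> (\<forall>k\<in>K. v k \<in> square_integrable \<mu>) \<and> (\<exists>A B. frame_bounds \<mu> K v A B)"

definition is_riesz_sequence :: "'a measure \<Rightarrow> 'k set \<Rightarrow> ('k \<Rightarrow> 'a \<Rightarrow> complex) \<Rightarrow> bool" where
  "is_riesz_sequence \<mu> K v \<longleftrightarrow> countable K \<and> (\<forall>k\<in>K. v k \<in> square_integrable \<mu>) \<and>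
     (\<exists>A>0. \<exists>B>0. \<forall>J a. finite J \<and> J \<subseteq> K \<longrightarrow>
        A * (\<Sum>k\<in>J. (cmod (a k))\<^sup>2) \<le> (L2_norm \<mu> (\<lambda>x. \<Sum>k\<in>J. a k * v k x))\<^sup>2 \<and>
        (L2_norm \<mu> (\<lambda>x. \<Sum>k\<in>J. a k * v k x))\<^sup>2 \<le> B * (\<Sum>k\<in>J. (cmod (a k))\<^sup>2))"

definition is_riesz_basis :: "'a measure \<Rightarrow> 'k set \<Rightarrow> ('k \<Rightarrow> 'a \<Rightarrow> complex) \<Rightarrow> bool" where
  "is_riesz_basis \<mu> K v \<longleftrightarrow> is_frame \<mu> K v \<and> is_riesz_sequence \<mu> K v"

definition optimal_frame_constants ::
    "'a measure \<Rightarrow> 'k set \<Rightarrow> ('k \<Rightarrow> 'a \<Rightarrow> complex) \<Rightarrow> real \<Rightarrow> real \<Rightarrow> bool" where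
  "optimal_frame_constants \<mu> K v A B \<longleftrightarrow> frame_bounds \<mu> K v A B \<and>
     (\<forall>A' B'. frame_bounds \<mu> K v A' B' \<longrightarrow> A' \<le> A \<and> B \<le> B')"


section \<open>Exponentials on unions of integer translates of the unit cube\<close>

definition vec_of_int :: "int ^ 'd \<Rightarrow> real ^ 'd" where
  "vec_of_int n = (\<chi> i. of_int (Finite_Cartesian_Product.vec_nth n i))"

definition unit_cube :: "(real ^ 'd) set" where
  "unit_cube = {x. \<forall>i. - (1/2) \<le> Finite_Cartesian_Product.vec_nth x i \<and>
                       Finite_Cartesian_Product.vec_nth x i < 1/2}"

definition multi_cube :: "nat \<Rightarrow> (nat \<Rightarrow> int ^ 'd) \<Rightarrow> (real ^ 'd) set" where
  "multi_cube N M = (\<Union>p\<in>{1..N}. (\<lambda>x. x + vec_of_int (M p)) ` unit_cube)"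

definition expo_index :: "nat \<Rightarrow> (nat \<times> (int ^ 'd)) set" where
  "expo_index N = {1..N} \<times> UNIV"

definition expo_family :: "real ^ 'd \<Rightarrow> nat \<times> (int ^ 'd) \<Rightarrow> real ^ 'd \<Rightarrow> complex" where
  "expo_family \<delta> = (\<lambda>(j, n) x.
     exp (2 * of_real pi * \<i> * of_real (inner (vec_of_int n + (real j - 1) *\<^sub>R \<delta>) x)))"

definition beta_tilde :: "nat \<Rightarrow> (nat \<Rightarrow> int ^ 'd) \<Rightarrow> real ^ 'd \<Rightarrow> nat \<Rightarrow> nat \<Rightarrow> real" where
  "beta_tilde N M \<delta> p q =
     (if p = q then real N
      else sin (pi * real N * inner \<delta> (vec_of_int (M q) - vec_of_int (M p))) /
           sin (pi * inner \<delta> (vec_of_int (M q) - vec_of_int (M p))))"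

text \<open>
  Matrix indices start at \<open>0\<close>, hence the shift. The matrix is real and symmetric, so its real
  spectrum contains all its eigenvalues.
\<close>

definition B_tilde :: "nat \<Rightarrow> (nat \<Rightarrow> int ^ 'd) \<Rightarrow> real ^ 'd \<Rightarrow> real mat" where
  "B_tilde N M \<delta> = Matrix.mat N N (\<lambda>(p, q). beta_tilde N M \<delta> (p + 1) (q + 1))"

end

theory Submission
  imports Defs
begin

text \<open>
  Put \<open>z\<^sub>p = exp (2 \<pi> i \<langle>\<delta>, M\<^sub>p\<rangle>)\<close>. Since \<open>\<langle>n, M\<^sub>p\<rangle>\<close> is an integer, the coefficients of \<open>w\<close> with respect to the
  \<open>j\<close>-th layer of the system are, up to a unimodular factor, the Fourier coefficients on the unit cube
  of \<open>\<Sum>\<^sub>p w (x + M\<^sub>p) (cnj z\<^sub>p) ^ (j - 1)\<close>. By Parseval the frame sum of \<open>w\<close> is therefore the integral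
  over the unit cube of the quadratic form of the Gram matrix of a Vandermonde system with nodes \<open>z\<^sub>p\<close>,
  evaluated at the vector \<open>(w (x + M\<^sub>p))\<^sub>p\<close>. Hence the optimal frame constants are the extremal
  eigenvalues of this Gram matrix, which is unitarily equivalent to \<open>B_tilde\<close>. It is singular exactly
  when two nodes coincide; if they do not, invertibility of the Vandermonde matrix also gives the
  Riesz sequence property.

  Completeness of the exponentials on the cube is obtained by approximating indicators of compact
  sets by continuous functions on the torus and applying the Stone--Weierstrass theorem there.
\<close>

text \<open>The form in the overview acts on complex vectors, whereas \<open>B_tilde\<close> is real
  and \<open>spectrum\<close> here is its real spectrum. After the diagonal rotation the real and
  imaginary parts of a vector decouple, so bounds for real symmetric matrices suffice. For these
  only one end of the spectrum needs work: the infimum of the Rayleigh quotient is an eigenvalue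
  because the matrix shifted by it is singular, which requires neither a minimiser nor a
  diagonalisation; negation gives the other end. The Vandermonde matrix acts in both directions. On
  vectors indexed by nodes it makes the Gram form definite; on vectors indexed by exponents it
  controls finite linear combinations of the system. The obstacle to completeness is the half-open
  cube: it is not compact, and the torus glues its opposite faces. Compact sets inside the cube
  still embed injectively in the torus, so their images are closed and distance functions there
  approximate their indicators.\<close>

unbundle no vec_syntax and no inner_syntax

section \<open>Rayleigh quotients of symmetric matrices\<close>

text \<open>Cauchy-Schwarz in each row; the constant is essentially the squared Frobenius
  norm.\<close>

lemma mult_mat_vec_norm_bound:
  fixes A :: "'a::real_normed_field mat"
  assumes A: "A \<in> carrier_mat n n"
  shows "\<exists>C>0. \<forall>v\<in>carrier_vec n.
           (\<Sum>i<n. (norm ((A *\<^sub>v v) $ i))\<^sup>2) \<le> C * (\<Sum>i<n. (norm (v $ i))\<^sup>2)"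
proof (intro exI conjI ballI)
  \<comment> \<open>The added 1 keeps the constant positive for the zero matrix.\<close>
  let ?C = "(\<Sum>i<n. \<Sum>j<n. (norm (A $$ (i,j)))\<^sup>2) + 1"
  show "?C > 0" by (intro add_nonneg_pos sum_nonneg) auto
  fix v :: "'a Matrix.vec" assume v: "v \<in> carrier_vec n"
  have "(\<Sum>i<n. (norm ((A *\<^sub>v v) $ i))\<^sup>2)
      \<le> (\<Sum>i<n. (\<Sum>j<n. (norm (A $$ (i,j)))\<^sup>2) * (\<Sum>j<n. (norm (v $ j))\<^sup>2))"
  proof (rule sum_mono)
    fix i assume "i \<in> {..<n}"
    then have "(A *\<^sub>v v) $ i = (\<Sum>j<n. A $$ (i,j) * v $ j)"
      using A v by (auto simp: scalar_prod_def atLeast0LessThan intro!: sum.cong)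
    then have "norm ((A *\<^sub>v v) $ i) \<le> (\<Sum>j<n. norm (A $$ (i,j)) * norm (v $ j))"
      by (simp add: sum_norm_le norm_mult)
    then have "(norm ((A *\<^sub>v v) $ i))\<^sup>2 \<le> (\<Sum>j<n. norm (A $$ (i,j)) * norm (v $ j))\<^sup>2"
      by (intro power_mono) auto
    also have "\<dots> \<le> (\<Sum>j<n. (norm (A $$ (i,j)))\<^sup>2) * (\<Sum>j<n. (norm (v $ j))\<^sup>2)"
      by (rule Cauchy_Schwarz_ineq_sum)
    finally show "(norm ((A *\<^sub>v v) $ i))\<^sup>2 \<le> \<dots>" .
  qed
  also have "\<dots> \<le> ?C * (\<Sum>i<n. (norm (v $ i))\<^sup>2)"
    unfolding sum_distrib_right[symmetric] by (intro mult_right_mono sum_nonneg) auto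
  finally show "(\<Sum>i<n. (norm ((A *\<^sub>v v) $ i))\<^sup>2) \<le> \<dots>" .
qed

text \<open>The norm bound for the inverse \<open>B\<close>, read backwards through v = B (A
  v).\<close>

lemma mult_mat_vec_bounded_below:
  fixes A :: "'a::real_normed_field mat"
  assumes A: "A \<in> carrier_mat n n" and det: "det A \<noteq> 0"
  shows "\<exists>c>0. \<forall>v\<in>carrier_vec n.
           c * (\<Sum>i<n. (norm (v $ i))\<^sup>2) \<le> (\<Sum>i<n. (norm ((A *\<^sub>v v) $ i))\<^sup>2)"
proof -
  obtain B where B: "B \<in> carrier_mat n n" and BA: "B * A = 1\<^sub>m n"
    using det_non_zero_imp_unit[OF A det, where b = undefined] 
    by (auto simp: Units_def ring_mat_simps)
  obtain C where C: "C > 0" "\<And>v. v \<in> carrier_vec n \<Longrightarrow>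
      (\<Sum>i<n. (norm ((B *\<^sub>v v) $ i))\<^sup>2) \<le> C * (\<Sum>i<n. (norm (v $ i))\<^sup>2)"
    using mult_mat_vec_norm_bound[OF B] by blast
  show ?thesis
  proof (intro exI[of _ "1 / C"] conjI ballI)
    fix v :: "'a Matrix.vec" assume v: "v \<in> carrier_vec n"
    have "B *\<^sub>v (A *\<^sub>v v) = v"
      using assoc_mult_mat_vec[OF B A v] BA v by simp
    then show "1 / C * (\<Sum>i<n. (norm (v $ i))\<^sup>2) \<le> (\<Sum>i<n. (norm ((A *\<^sub>v v) $ i))\<^sup>2)"
      using C(2)[of "A *\<^sub>v v"] A v C(1) by (simp add: field_simps)
  qed (use C in auto)
qed

lemma scalar_prod_self_eq_sum:
  fixes v :: "real Matrix.vec"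
  assumes "v \<in> carrier_vec n"
  shows "v \<bullet> v = (\<Sum>i<n. (norm (v $ i))\<^sup>2)"
  using assms by (auto simp: scalar_prod_def atLeast0LessThan power2_eq_square intro!: sum.cong)

lemma two_scalar_prod_le:
  fixes v w :: "real Matrix.vec"
  assumes "v \<in> carrier_vec n" "w \<in> carrier_vec n"
  shows "2 * \<bar>v \<bullet> w\<bar> \<le> v \<bullet> v + w \<bullet> w"
proof -
  have "2 * \<bar>a * b\<bar> \<le> a * a + b * b" for a b :: real
    using sum_squares_bound[of "\<bar>a\<bar>" "\<bar>b\<bar>"] by (simp add: power2_eq_square abs_mult)
  then have "2 * (\<Sum>i<n. \<bar>v $ i * w $ i\<bar>) \<le> (\<Sum>i<n. v $ i * v $ i + w $ i * w $ i)"
    unfolding sum_distrib_left by (intro sum_mono)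
  then have "2 * \<bar>\<Sum>i<n. v $ i * w $ i\<bar> \<le> (\<Sum>i<n. v $ i * v $ i + w $ i * w $ i)"
    using sum_abs[of "\<lambda>i. v $ i * w $ i" "{..<n}"] by linarith
  then show ?thesis
    using assms by (simp add: scalar_prod_def atLeast0LessThan sum.distrib)
qed

text \<open>Let l be the infimum of the quadratic form on the unit sphere and C = A - l, which is
  positive semidefinite. If C were invertible, C v would be bounded below in terms of v, and
  semidefiniteness turns this into a positive lower bound for the form of C on the unit sphere. The
  infimum would then exceed l. So C is singular and a kernel vector is an eigenvector.\<close>

lemma symmetric_mat_min_eigenvalue:
  fixes A :: "real mat"
  assumes A: "A \<in> carrier_mat n n" and n: "n > 0" and sym: "transpose_mat A = A"
  shows "\<exists>l\<in>spectrum A. \<forall>v\<in>carrier_vec n. l * (v \<bullet> v) \<le> v \<bullet> (A *\<^sub>v v)"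
proof -
  define S where "S = {v \<bullet> (A *\<^sub>v v) | v. v \<in> carrier_vec n \<and> v \<bullet> v = 1}"
  define l where "l = Inf S"
  define C where "C = A - l \<cdot>\<^sub>m 1\<^sub>m n"
  have C: "C \<in> carrier_mat n n" unfolding C_def by (intro minus_carrier_mat smult_carrier_mat one_carrier_mat)
  have Cv: "C *\<^sub>v v = A *\<^sub>v v - l \<cdot>\<^sub>v v" if v: "v \<in> carrier_vec n" for v
  proof (rule eq_vecI)
    fix i assume "i < dim_vec (A *\<^sub>v v - l \<cdot>\<^sub>v v)"
    then have i: "i < n" using v by simp
    then have "row C i = row A i - l \<cdot>\<^sub>v unit_vec n i"
      using A by (auto simp: C_def)
    then show "(C *\<^sub>v v) $ i = (A *\<^sub>v v - l \<cdot>\<^sub>v v) $ i"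
      using i v A C by (simp add: minus_scalar_prod_distrib[of _ n])
  qed (use v C in simp)
  have qC: "v \<bullet> (C *\<^sub>v v) = v \<bullet> (A *\<^sub>v v) - l * (v \<bullet> v)" if v: "v \<in> carrier_vec n" for v
    using A v by (simp add: Cv scalar_prod_minus_distrib[of _ n])
  have symC: "(C *\<^sub>v v) \<bullet> w = v \<bullet> (C *\<^sub>v w)" if v: "v \<in> carrier_vec n" and w: "w \<in> carrier_vec n" for v w
  proof -
    have "transpose_mat C = C"
      unfolding C_def using sym A by (auto simp: transpose_minus[of _ n n])
    then show ?thesis using transpose_vec_mult_scalar[OF C w v] by simp
  qed
  obtain K0 where K0: "K0 > 0" "\<And>v. v \<in> carrier_vec n \<Longrightarrow> (A *\<^sub>v v) \<bullet> (A *\<^sub>v v) \<le> K0 * (v \<bullet> v)"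
    using mult_mat_vec_norm_bound[OF A] A scalar_prod_self_eq_sum by (metis mult_mat_vec_carrier)
  have bdd: "bdd_below S"
  proof (rule bdd_belowI)
    fix s assume "s \<in> S"
    then obtain v where v: "v \<in> carrier_vec n" "v \<bullet> v = 1" "s = v \<bullet> (A *\<^sub>v v)" by (auto simp: S_def)
    have "2 * \<bar>v \<bullet> (A *\<^sub>v v)\<bar> \<le> v \<bullet> v + (A *\<^sub>v v) \<bullet> (A *\<^sub>v v)"
      using v A by (intro two_scalar_prod_le) auto
    then have "2 * \<bar>s\<bar> \<le> 1 + K0" using v K0(2)[OF v(1)] by simp
    then have "\<bar>s\<bar> \<le> (1 + K0) / 2" by simp
    then show "- ((1 + K0) / 2) \<le> s" by (simp only: abs_le_iff minus_le_iff)
  qed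
  have u: "unit_vec n 0 \<bullet> (unit_vec n 0 :: real Matrix.vec) = 1"
    using n by (simp add: scalar_prod_left_unit)
  then have ne: "S \<noteq> {}" unfolding S_def by (auto intro!: exI[of _ "unit_vec n 0"])
  have psd: "0 \<le> v \<bullet> (C *\<^sub>v v)" if v: "v \<in> carrier_vec n" for v
  proof (cases "v \<bullet> v = 0")
    case True
    then have "\<forall>i<n. v $ i = 0"
      using scalar_prod_self_eq_sum[OF v] by (auto simp: sum_nonneg_eq_0_iff)
    then have "v = 0\<^sub>v n" using v by auto
    then show ?thesis using C by simp
  next
    case False
    then have pos: "v \<bullet> v > 0" using scalar_prod_self_eq_sum[OF v] by (metis less_eq_real_def sum_nonneg zero_le_power2)
    define r where "r = 1 / sqrt (v \<bullet> v)"
    have r: "r * (r * (v \<bullet> v)) = 1" using pos by (simp add: r_def)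
    have "(r \<cdot>\<^sub>v v) \<bullet> (A *\<^sub>v (r \<cdot>\<^sub>v v)) \<in> S"
      unfolding S_def using v r by (auto intro!: exI[of _ "r \<cdot>\<^sub>v v"])
    then have "l \<le> (r \<cdot>\<^sub>v v) \<bullet> (A *\<^sub>v (r \<cdot>\<^sub>v v))"
      unfolding l_def using bdd by (rule cInf_lower)
    also have "\<dots> = r * (r * (v \<bullet> (A *\<^sub>v v)))"
      using v A by (simp add: mult_mat_vec[OF A v])
    finally have "l * (v \<bullet> v) \<le> r * (r * (v \<bullet> (A *\<^sub>v v))) * (v \<bullet> v)"
      using pos by (intro mult_right_mono) auto
    also have "\<dots> = (r * (r * (v \<bullet> v))) * (v \<bullet> (A *\<^sub>v v))" by (simp only: mult_ac)
    finally show ?thesis using r qC[OF v] by simp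
  qed
  have "det C = 0"
  proof (rule ccontr)
    assume "det C \<noteq> 0"
    then obtain c where c: "c > 0" "\<And>v. v \<in> carrier_vec n \<Longrightarrow> c * (v \<bullet> v) \<le> (C *\<^sub>v v) \<bullet> (C *\<^sub>v v)"
      using mult_mat_vec_bounded_below[OF C] C scalar_prod_self_eq_sum by (metis mult_mat_vec_carrier)
    obtain K1 where K1: "K1 > 0" "\<And>v. v \<in> carrier_vec n \<Longrightarrow> (C *\<^sub>v v) \<bullet> (C *\<^sub>v v) \<le> K1 * (v \<bullet> v)"
      using mult_mat_vec_norm_bound[OF C] C scalar_prod_self_eq_sum by (metis mult_mat_vec_carrier)
    \<comment> \<open>From 2 |v . C v| \<le> v . v + C v . C v \<le> (1 + K1) (v . v).\<close>
    define K where "K = (1 + K1) / 2"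
    have K: "K > 0" "\<And>v. v \<in> carrier_vec n \<Longrightarrow> v \<bullet> (C *\<^sub>v v) \<le> K * (v \<bullet> v)"
      subgoal using K1 by (simp add: K_def)
      subgoal for v using two_scalar_prod_le[of v n "C *\<^sub>v v"] K1(2)[of v] C 
        by (auto simp: K_def field_simps)
      done
    have gap: "c / K * (v \<bullet> v) \<le> v \<bullet> (C *\<^sub>v v)" if v: "v \<in> carrier_vec n" for v
    proof -
      define w where "w = C *\<^sub>v v"
      \<comment> \<open>Semidefiniteness is tested on v + t w with w = C v. This t minimises the
        upper bound v . w + 2 t (w . w) + t t K (w . w), and the outcome is v . w \<ge> (w . w) /
        K.\<close>
      define t where "t = - 1 / K"
      have w: "w \<in> carrier_vec n" using C v by (simp add: w_def)
      have Cw: "C *\<^sub>v w \<in> carrier_vec n" using C w by (rule mult_mat_vec_carrier)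
      have Ce: "C *\<^sub>v (v + t \<cdot>\<^sub>v w) = w + t \<cdot>\<^sub>v (C *\<^sub>v w)"
        using v w C by (simp add: mult_add_distrib_mat_vec[of _ n n] mult_mat_vec w_def)
      have "(v + t \<cdot>\<^sub>v w) \<bullet> (w + t \<cdot>\<^sub>v (C *\<^sub>v w))
          = v \<bullet> w + t * (v \<bullet> (C *\<^sub>v w)) + t * (w \<bullet> w) + t * t * (w \<bullet> (C *\<^sub>v w))"
        using v w Cw by (simp add: scalar_prod_add_distrib[of _ n] add_scalar_prod_distrib[of _ n] algebra_simps)
      moreover have "v \<bullet> (C *\<^sub>v w) = w \<bullet> w" using symC[OF v w] by (simp add: w_def)
      moreover have "0 \<le> (v + t \<cdot>\<^sub>v w) \<bullet> (w + t \<cdot>\<^sub>v (C *\<^sub>v w))"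
        using psd[of "v + t \<cdot>\<^sub>v w"] v w Ce by simp
      ultimately have "0 \<le> v \<bullet> w + 2 * t * (w \<bullet> w) + t * t * (w \<bullet> (C *\<^sub>v w))" by simp
      also have "\<dots> \<le> v \<bullet> w + 2 * t * (w \<bullet> w) + t * t * (K * (w \<bullet> w))"
        using K(2)[OF w] by (intro add_left_mono mult_left_mono) auto
      also have "\<dots> = v \<bullet> w - (w \<bullet> w) / K" using K(1) by (simp add: t_def field_simps)
      finally have "(w \<bullet> w) / K \<le> v \<bullet> w" by simp
      moreover have "c * (v \<bullet> v) / K \<le> (w \<bullet> w) / K"
        using c(2)[OF v] K(1) by (intro divide_right_mono) (auto simp: w_def)
      ultimately show ?thesis by (simp add: w_def)
    qed
    \<comment> \<open>The gap pushes every value of the form on the unit sphere up to at least l + c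
      / K, against the choice of l as their infimum.\<close>
    have "l + c / K \<le> Inf S"
    proof (rule cInf_greatest[OF ne])
      fix s assume "s \<in> S"
      then obtain v where v: "v \<in> carrier_vec n" "v \<bullet> v = 1" "s = v \<bullet> (A *\<^sub>v v)" by (auto simp: S_def)
      then show "l + c / K \<le> s" using gap[OF v(1)] qC[OF v(1)] by simp
    qed
    moreover have "c / K > 0" using c(1) K(1) by simp
    ultimately show False by (simp add: l_def)
  qed
  then obtain v where v: "v \<in> carrier_vec n" "v \<noteq> 0\<^sub>v n" "C *\<^sub>v v = 0\<^sub>v n"
    using det_0_iff_vec_prod_zero[OF C] by auto
  have "A *\<^sub>v v = l \<cdot>\<^sub>v v"
  proof (rule eq_vecI)
    fix i assume i: "i < dim_vec (l \<cdot>\<^sub>v v)"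
    have "(A *\<^sub>v v - l \<cdot>\<^sub>v v) $ i = 0" using v i Cv[OF v(1)] by (metis carrier_vecD index_smult_vec(2) index_zero_vec(1))
    then show "(A *\<^sub>v v) $ i = (l \<cdot>\<^sub>v v) $ i" using i v A by simp
  qed (use A v in simp)
  then have "l \<in> spectrum A" using v A by (auto simp: spectrum_def eigenvalue_def eigenvector_def)
  then show ?thesis using psd qC by force
qed

text \<open>The eigenvalue found above makes the spectrum nonempty and is at least its minimum, so
  the lower bound weakens to the minimum.\<close>

lemma symmetric_mat_Min_spectrum:
  fixes A :: "real mat"
  assumes A: "A \<in> carrier_mat n n" and n: "n > 0" and sym: "transpose_mat A = A"
  shows "Min (spectrum A) \<in> spectrum A"
    and "v \<in> carrier_vec n \<Longrightarrow> Min (spectrum A) * (v \<bullet> v) \<le> v \<bullet> (A *\<^sub>v v)"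
proof -
  obtain l where l: "l \<in> spectrum A" "\<And>v. v \<in> carrier_vec n \<Longrightarrow> l * (v \<bullet> v) \<le> v \<bullet> (A *\<^sub>v v)"
    using symmetric_mat_min_eigenvalue[OF assms] by blast
  have fin: "finite (spectrum A)" by (rule card_finite_spectrum[OF A])
  show "Min (spectrum A) \<in> spectrum A" using l(1) fin by (intro Min_in) auto
  assume v: "v \<in> carrier_vec n"
  have "Min (spectrum A) * (v \<bullet> v) \<le> l * (v \<bullet> v)"
    using l(1) fin scalar_prod_self_eq_sum[OF v] by (intro mult_right_mono) (auto simp: sum_nonneg)
  with l(2)[OF v] show "Min (spectrum A) * (v \<bullet> v) \<le> v \<bullet> (A *\<^sub>v v)" by simp
qed

text \<open>Negation is an involution, so one inclusion, proved for arbitrary matrices, yields both.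
  It transports the minimum of a spectrum to a maximum.\<close>

lemma spectrum_uminus:
  fixes A :: "'a::field mat"
  assumes A: "A \<in> carrier_mat n n"
  shows "spectrum (- A) = uminus ` spectrum A"
proof -
  have neg: "- k \<in> spectrum (- B)" if B: "B \<in> carrier_mat n n" and k: "k \<in> spectrum B" for k and B :: "'a mat"
  proof -
    obtain v where v: "v \<in> carrier_vec n" "v \<noteq> 0\<^sub>v n" "B *\<^sub>v v = k \<cdot>\<^sub>v v"
      using k B by (auto simp: spectrum_def eigenvalue_def eigenvector_def)
    have "(- B) *\<^sub>v v = - (B *\<^sub>v v)" using B v by simp
    also have "\<dots> = (- k) \<cdot>\<^sub>v v" unfolding v(3) by auto
    finally show ?thesis using v B by (auto simp: spectrum_def eigenvalue_def eigenvector_def)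
  qed
  show ?thesis
  proof (intro equalityI subsetI)
    fix k assume "k \<in> spectrum (- A)"
    then have "- k \<in> spectrum (- (- A))" using A by (intro neg) auto
    then show "k \<in> uminus ` spectrum A" by (metis imageI minus_minus uminus_uminus_mat)
  qed (use neg[OF A] in auto)
qed

lemma symmetric_mat_Max_spectrum:
  fixes A :: "real mat"
  assumes A: "A \<in> carrier_mat n n" and n: "n > 0" and sym: "transpose_mat A = A"
  shows "Max (spectrum A) \<in> spectrum A"
    and "v \<in> carrier_vec n \<Longrightarrow> v \<bullet> (A *\<^sub>v v) \<le> Max (spectrum A) * (v \<bullet> v)"
proof -
  have A': "- A \<in> carrier_mat n n" and sym': "transpose_mat (- A) = - A"
    using A sym by (auto simp: transpose_uminus)
  have fin: "finite (spectrum A)" by (rule card_finite_spectrum[OF A])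
  have ne: "spectrum A \<noteq> {}" using symmetric_mat_Min_spectrum(1)[OF assms] by auto
  show "Max (spectrum A) \<in> spectrum A" using fin ne by (rule Max_in)
  assume v: "v \<in> carrier_vec n"
  have "Min (spectrum (- A)) = - Max (spectrum A)"
    unfolding spectrum_uminus[OF A] using fin ne by (simp add: minus_Max_eq_Min)
  then show "v \<bullet> (A *\<^sub>v v) \<le> Max (spectrum A) * (v \<bullet> v)"
    using symmetric_mat_Min_spectrum(2)[OF A' n sym' v] A v by simp
qed

section \<open>Vandermonde systems and the matrix of the frame operator\<close>

lemma nonzero_vec_index:
  assumes "v \<in> carrier_vec n" "v \<noteq> 0\<^sub>v n"
  shows "\<exists>k<n. v $ k \<noteq> 0"
proof (rule ccontr)
  assume "\<not> (\<exists>k<n. v $ k \<noteq> 0)"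
  then have "v = 0\<^sub>v n" using assms(1) by (intro eq_vecI) auto
  with assms(2) show False ..
qed

text \<open>A kernel vector would be the coefficient vector of a nonzero polynomial of degree at
  most N - 1 with N distinct roots. Row i belongs to node i + 1, since nodes are numbered from 1 and
  rows from 0.\<close>

lemma det_vandermonde_nonzero:
  fixes z :: "nat \<Rightarrow> 'a::real_normed_field"
  assumes inj: "inj_on z {1..N}"
  shows "det (Matrix.mat N N (\<lambda>(i, j). z (Suc i) ^ j)) \<noteq> 0" (is "det ?W \<noteq> 0")
proof
  assume "det ?W = 0"
  then obtain v where v: "v \<in> carrier_vec N" "v \<noteq> 0\<^sub>v N" "?W *\<^sub>v v = 0\<^sub>v N"
    using det_0_iff_vec_prod_zero[of ?W N] by auto
  then obtain k where k: "k < N" "v $ k \<noteq> 0" using nonzero_vec_index by blast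
  have root: "(\<Sum>j\<le>N - 1. v $ j * z p ^ j) = 0" if p: "p \<in> {1..N}" for p
  proof -
    have "(?W *\<^sub>v v) $ (p - 1) = (\<Sum>j<N. v $ j * z p ^ j)"
      using p v(1) by (auto simp: scalar_prod_def atLeast0LessThan mult.commute intro!: sum.cong)
    moreover have "(?W *\<^sub>v v) $ (p - 1) = 0" unfolding v(3) using p by (intro index_zero_vec(1)) auto
    moreover have "{..<N} = {..N - 1}" using k(1) by auto
    ultimately show ?thesis by metis
  qed
  have "finite {x. (\<Sum>j\<le>N - 1. v $ j * x ^ j) = 0} \<and> card {x. (\<Sum>j\<le>N - 1. v $ j * x ^ j) = 0} \<le> N - 1"
    using Transcendental.polyfun_rootbound[of "\<lambda>j. v $ j" k "N - 1"] k by auto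
  moreover have "z ` {1..N} \<subseteq> {x. (\<Sum>j\<le>N - 1. v $ j * x ^ j) = 0}" using root by blast
  ultimately have "card (z ` {1..N}) \<le> N - 1" by (meson card_mono order_trans)
  then show False using card_image[OF inj] k(1) by simp
qed

text \<open>The direction for the Riesz sequence property: g is indexed by the exponents, and the
  inner sum is a polynomial evaluated at a node.\<close>

lemma vandermonde_bounds:
  fixes z :: "nat \<Rightarrow> complex"
  assumes inj: "inj_on z {1..N}"
  shows "\<exists>c>0. \<exists>C>0. \<forall>g. c * (\<Sum>j=1..N. (cmod (g j))\<^sup>2) \<le> (\<Sum>p=1..N. (cmod (\<Sum>j=1..N. g j * z p ^ (j - 1)))\<^sup>2)
       \<and> (\<Sum>p=1..N. (cmod (\<Sum>j=1..N. g j * z p ^ (j - 1)))\<^sup>2) \<le> C * (\<Sum>j=1..N. (cmod (g j))\<^sup>2)"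
proof -
  let ?W = "Matrix.mat N N (\<lambda>(i, j). z (Suc i) ^ j)"
  have W: "?W \<in> carrier_mat N N" by simp
  obtain c where c: "c > 0" "\<And>v. v \<in> carrier_vec N \<Longrightarrow>
      c * (\<Sum>i<N. (cmod (v $ i))\<^sup>2) \<le> (\<Sum>i<N. (cmod ((?W *\<^sub>v v) $ i))\<^sup>2)"
    using mult_mat_vec_bounded_below[OF W det_vandermonde_nonzero[OF inj]] by blast
  obtain C where C: "C > 0" "\<And>v. v \<in> carrier_vec N \<Longrightarrow>
      (\<Sum>i<N. (cmod ((?W *\<^sub>v v) $ i))\<^sup>2) \<le> C * (\<Sum>i<N. (cmod (v $ i))\<^sup>2)"
    using mult_mat_vec_norm_bound[OF W] by blast
  have "(\<Sum>i<N. (cmod ((?W *\<^sub>v vec N (\<lambda>j. g (Suc j))) $ i))\<^sup>2)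
      = (\<Sum>p=1..N. (cmod (\<Sum>j=1..N. g j * z p ^ (j - 1)))\<^sup>2)" for g
    by (auto simp: sum.atLeast1_atMost_eq scalar_prod_def atLeast0LessThan mult.commute intro!: sum.cong)
  moreover have "(\<Sum>i<N. (cmod (vec N (\<lambda>j. g (Suc j)) $ i))\<^sup>2) = (\<Sum>j=1..N. (cmod (g j))\<^sup>2)" for g :: "nat \<Rightarrow> complex"
    by (simp add: sum.atLeast1_atMost_eq)
  ultimately show ?thesis
    using c(1) C(1) c(2)[of "vec N (\<lambda>j. g (Suc j))" for g] C(2)[of "vec N (\<lambda>j. g (Suc j))" for g]
    by (intro exI[of _ c] exI[of _ C] conjI allI) (simp_all del: index_mult_mat_vec)
qed

text \<open>The direction for the lower frame bound: u is indexed by the nodes, so the transposed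
  matrix acts.\<close>

lemma vandermonde_transpose_bounded_below:
  fixes z :: "nat \<Rightarrow> complex"
  assumes inj: "inj_on z {1..N}"
  shows "\<exists>c>0. \<forall>u. c * (\<Sum>p=1..N. (cmod (u p))\<^sup>2) \<le> (\<Sum>j=1..N. (cmod (\<Sum>p=1..N. u p * z p ^ (j - 1)))\<^sup>2)"
proof -
  let ?W = "transpose_mat (Matrix.mat N N (\<lambda>(i, j). z (Suc i) ^ j))"
  have W: "?W \<in> carrier_mat N N" by simp
  have "det ?W \<noteq> 0" using det_vandermonde_nonzero[OF inj] det_transpose[of "Matrix.mat N N (\<lambda>(i, j). z (Suc i) ^ j)" N] by simp
  then obtain c where c: "c > 0" "\<And>v. v \<in> carrier_vec N \<Longrightarrow>
      c * (\<Sum>i<N. (cmod (v $ i))\<^sup>2) \<le> (\<Sum>i<N. (cmod ((?W *\<^sub>v v) $ i))\<^sup>2)"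
    using mult_mat_vec_bounded_below[OF W] by blast
  have "(\<Sum>i<N. (cmod ((?W *\<^sub>v vec N (\<lambda>j. g (Suc j))) $ i))\<^sup>2)
      = (\<Sum>j=1..N. (cmod (\<Sum>p=1..N. g p * z p ^ (j - 1)))\<^sup>2)" for g
    by (auto simp: sum.atLeast1_atMost_eq scalar_prod_def atLeast0LessThan mult.commute intro!: sum.cong)
  moreover have "(\<Sum>i<N. (cmod (vec N (\<lambda>j. g (Suc j)) $ i))\<^sup>2) = (\<Sum>j=1..N. (cmod (g j))\<^sup>2)" for g :: "nat \<Rightarrow> complex"
    by (simp add: sum.atLeast1_atMost_eq)
  ultimately show ?thesis
    using c(1) c(2)[of "vec N (\<lambda>j. g (Suc j))" for g]
    by (intro exI[of _ c] conjI allI) (simp_all del: index_mult_mat_vec)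
qed

text \<open>The Dirichlet kernel. In the quotient of the geometric sum, numerator and denominator
  both have the form cis (2 x) - 1 = cis x * 2 i sin x. The phase remains because the exponents 0,
  ..., N - 1 are not centred at 0.\<close>

lemma sum_cis_geometric:
  assumes "sin (pi * s) \<noteq> 0"
  shows "(\<Sum>j=1..N. cis (2 * pi * s) ^ (j - 1))
       = cis (pi * (real N - 1) * s) * of_real (sin (pi * real N * s) / sin (pi * s))"
proof -
  have sin: "2 * \<i> * of_real (sin x) = cis x - cis (- x)" for x
    by (simp add: complex_eq_iff)
  have diff: "cis (2 * x) - 1 = cis x * (2 * \<i> * of_real (sin x))" for x
    by (simp add: sin right_diff_distrib cis_mult)
  have ne: "cis (2 * pi * s) \<noteq> 1"
    using assms diff[of "pi * s"] by (auto simp: mult.assoc)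
  have "(\<Sum>j=1..N. cis (2 * pi * s) ^ (j - 1)) = (\<Sum>j<N. cis (2 * pi * s) ^ j)"
    by (simp add: sum.atLeast1_atMost_eq)
  also have "\<dots> = (cis (2 * pi * s) ^ N - 1) / (cis (2 * pi * s) - 1)"
    using ne by (rule geometric_sum)
  also have "cis (2 * pi * s) ^ N = cis (2 * (pi * real N * s))"
    by (simp add: Complex.DeMoivre mult_ac)
  also have "(cis (2 * (pi * real N * s)) - 1) / (cis (2 * pi * s) - 1)
      = (cis (pi * real N * s) / cis (pi * s)) * of_real (sin (pi * real N * s) / sin (pi * s))"
    unfolding diff mult.assoc[of 2 pi s] by simp
  also have "cis (pi * real N * s) / cis (pi * s) = cis (pi * (real N - 1) * s)"
    by (simp add: cis_divide algebra_simps)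
  finally show ?thesis .
qed

section \<open>The Gram form of the nodes and its relation to the real matrix\<close>

text \<open>The nodes are conjugated because \<open>L2_inner\<close> conjugates its second argument,
  which in the frame sum is the exponential.\<close>

definition vandermonde_form :: "nat \<Rightarrow> (nat \<Rightarrow> complex) \<Rightarrow> (nat \<Rightarrow> complex) \<Rightarrow> real" where
  "vandermonde_form N z u = (\<Sum>j=1..N. (cmod (\<Sum>p=1..N. u p * cnj (z p) ^ (j - 1)))\<^sup>2)"

lemma vandermonde_form_expand:
  "of_real (vandermonde_form N z u)
     = (\<Sum>p=1..N. \<Sum>q=1..N. u p * cnj (u q) * (\<Sum>j=1..N. (cnj (z p) * z q) ^ (j - 1)))"
proof -
  have "of_real (vandermonde_form N z u) = (\<Sum>j=1..N. \<Sum>p=1..N. \<Sum>q=1..N. u p * cnj (u q) * (cnj (z p) * z q) ^ (j - 1))"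
    unfolding vandermonde_form_def of_real_sum complex_norm_square
    by (simp add: sum_product power_mult_distrib mult_ac)
  also have "\<dots> = (\<Sum>p=1..N. \<Sum>j=1..N. \<Sum>q=1..N. u p * cnj (u q) * (cnj (z p) * z q) ^ (j - 1))"
    by (rule sum.swap)
  also have "\<dots> = (\<Sum>p=1..N. \<Sum>q=1..N. \<Sum>j=1..N. u p * cnj (u q) * (cnj (z p) * z q) ^ (j - 1))"
    by (intro sum.cong sum.swap refl)
  finally show ?thesis by (simp add: sum_distrib_left)
qed

text \<open>The number t_p for which z_p = \<open>cis (2 * pi * node_arg M \<delta> p)\<close>: the
  angle of the node in full turns.\<close>

definition node_arg :: "(nat \<Rightarrow> int ^ 'd::finite) \<Rightarrow> real ^ 'd \<Rightarrow> nat \<Rightarrow> real" where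
  "node_arg M \<delta> p = inner \<delta> (vec_of_int (M p))"

lemma beta_tilde_sym: "beta_tilde N M \<delta> p q = beta_tilde N M \<delta> q p"
proof -
  have "inner \<delta> (vec_of_int (M q) - vec_of_int (M p)) = - inner \<delta> (vec_of_int (M p) - vec_of_int (M q))"
    by (simp add: inner_diff_right)
  then show ?thesis by (simp add: beta_tilde_def)
qed

lemma B_tilde_carrier: "B_tilde N M \<delta> \<in> carrier_mat N N"
  by (simp add: B_tilde_def)

lemma B_tilde_sym: "transpose_mat (B_tilde N M \<delta>) = B_tilde N M \<delta>"
  by (auto simp: B_tilde_def beta_tilde_sym)

text \<open>The bridge between matrix entries numbered from 0 and families indexed by
  \<open>{1..N}\<close>.\<close>

lemma B_tilde_form:
  "vec N (\<lambda>i. a (Suc i)) \<bullet> (B_tilde N M \<delta> *\<^sub>v vec N (\<lambda>i. a (Suc i)))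
     = (\<Sum>p=1..N. \<Sum>q=1..N. a p * a q * beta_tilde N M \<delta> p q)"
  by (auto simp: B_tilde_def sum.atLeast1_atMost_eq scalar_prod_def atLeast0LessThan sum_distrib_left mult_ac
           intro!: sum.cong)

lemma scalar_prod_vec_Suc:
  "vec N (\<lambda>i. a (Suc i)) \<bullet> vec N (\<lambda>i. a (Suc i)) = (\<Sum>p=1..N. (a p)\<^sup>2 :: real)"
  by (auto simp: sum.atLeast1_atMost_eq scalar_prod_def atLeast0LessThan power2_eq_square)

text \<open>Lets the bounds for real vectors be applied separately to the real and imaginary parts
  of a rotated complex vector and then added.\<close>

lemma sum_cmod_unimodular:
  assumes "\<And>p. cmod (r p) = 1"
  shows "(\<Sum>p\<in>I. (Re (u p * r p))\<^sup>2) + (\<Sum>p\<in>I. (Im (u p * r p))\<^sup>2) = (\<Sum>p\<in>I. (cmod (u p))\<^sup>2)"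
proof -
  have "(Re (u p * r p))\<^sup>2 + (Im (u p * r p))\<^sup>2 = (cmod (u p))\<^sup>2" for p
    using assms[of p] by (simp only: cmod_power2[symmetric] norm_mult) simp
  then show ?thesis by (simp only: sum.distrib[symmetric])
qed

context
  fixes N :: nat and M :: "nat \<Rightarrow> int ^ 'd::finite" and \<delta> :: "real ^ 'd"
  assumes noninteger: "\<And>p q. p \<in> {1..N} \<Longrightarrow> q \<in> {1..N} \<Longrightarrow> p \<noteq> q \<Longrightarrow>
      inner (vec_of_int (M p) - vec_of_int (M q)) \<delta> \<notin> \<int>"
begin

text \<open>The phase of the Dirichlet kernel at t_q - t_p splits into one factor for p and the
  conjugate of the same factor for q. This splitting is what a diagonal unitary conjugation can
  absorb. On the diagonal the ratio of the nodes is 1 and the sum is N.\<close>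

lemma sum_node_quotient:
  assumes "p \<in> {1..N}" "q \<in> {1..N}"
  shows "(\<Sum>j=1..N. (cnj (cis (2 * pi * node_arg M \<delta> p)) * cis (2 * pi * node_arg M \<delta> q)) ^ (j - 1))
     = cis (- (pi * (real N - 1) * node_arg M \<delta> p)) * cnj (cis (- (pi * (real N - 1) * node_arg M \<delta> q)))
       * of_real (beta_tilde N M \<delta> p q)"
proof (cases "p = q")
  case True
  then show ?thesis by (simp add: beta_tilde_def cis_cnj cis_mult)
next
  case False
  define s where "s = node_arg M \<delta> q - node_arg M \<delta> p"
  have s: "inner \<delta> (vec_of_int (M q) - vec_of_int (M p)) = s"
    by (simp add: s_def node_arg_def inner_diff_right)
  have "s \<notin> \<int>"
    using noninteger[OF assms(2,1)] False s by (simp add: inner_commute)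
  then have "sin (pi * s) \<noteq> 0"
    by (auto simp: sin_zero_iff_int2)
  then have "(\<Sum>j=1..N. cis (2 * pi * s) ^ (j - 1))
       = cis (pi * (real N - 1) * s) * of_real (beta_tilde N M \<delta> p q)"
    using False sum_cis_geometric[of s N] by (simp add: beta_tilde_def s)
  moreover have "cnj (cis (2 * pi * node_arg M \<delta> p)) * cis (2 * pi * node_arg M \<delta> q) = cis (2 * pi * s)"
    by (simp add: cis_cnj cis_mult s_def algebra_simps)
  moreover have "cis (- (pi * (real N - 1) * node_arg M \<delta> p)) * cnj (cis (- (pi * (real N - 1) * node_arg M \<delta> q)))
      = cis (pi * (real N - 1) * s)"
    by (simp add: cis_cnj cis_mult s_def algebra_simps)
  ultimately show ?thesis by simp
qed

text \<open>Conjugation by the diagonal unitary matrix with entries \<open>cis (- \<pi> (N - 1) t\<^sub>p)\<close> turns the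
  Gram matrix of the Vandermonde system into the real matrix \<open>B_tilde\<close>.\<close>

lemma vandermonde_form_eq_B_tilde:
  defines "r \<equiv> \<lambda>p. cis (- (pi * (real N - 1) * node_arg M \<delta> p))"
  shows "vandermonde_form N (\<lambda>p. cis (2 * pi * node_arg M \<delta> p)) u
     = (\<Sum>p=1..N. \<Sum>q=1..N. Re (u p * r p) * Re (u q * r q) * beta_tilde N M \<delta> p q)
     + (\<Sum>p=1..N. \<Sum>q=1..N. Im (u p * r p) * Im (u q * r q) * beta_tilde N M \<delta> p q)"
proof -
  have quot: "(\<Sum>j=1..N. (cnj (cis (2 * pi * node_arg M \<delta> p)) * cis (2 * pi * node_arg M \<delta> q)) ^ (j - 1))
      = r p * cnj (r q) * of_real (beta_tilde N M \<delta> p q)" if "p \<in> {1..N}" "q \<in> {1..N}" for p q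
    unfolding r_def by (rule sum_node_quotient[OF that])
  have "complex_of_real (vandermonde_form N (\<lambda>p. cis (2 * pi * node_arg M \<delta> p)) u)
      = (\<Sum>p=1..N. \<Sum>q=1..N. (u p * r p) * cnj (u q * r q) * of_real (beta_tilde N M \<delta> p q))"
    unfolding vandermonde_form_expand
  proof (intro sum.cong refl)
    fix p q assume pq: "p \<in> {1..N}" "q \<in> {1..N}"
    show "u p * cnj (u q) * (\<Sum>j=1..N. (cnj (cis (2 * pi * node_arg M \<delta> p)) * cis (2 * pi * node_arg M \<delta> q)) ^ (j - 1))
        = (u p * r p) * cnj (u q * r q) * of_real (beta_tilde N M \<delta> p q)"
      unfolding quot[OF pq] by (simp only: complex_cnj_mult mult_ac)
  qed
  then have "vandermonde_form N (\<lambda>p. cis (2 * pi * node_arg M \<delta> p)) u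
      = Re (\<Sum>p=1..N. \<Sum>q=1..N. (u p * r p) * cnj (u q * r q) * of_real (beta_tilde N M \<delta> p q))"
    by (metis Re_complex_of_real)
  \<comment> \<open>The entries of \<open>beta_tilde\<close> are real, and Re (a * cnj b) = Re a *
    Re b + Im a * Im b.\<close>
  also have "\<dots> = (\<Sum>p=1..N. \<Sum>q=1..N. Re (u p * r p) * Re (u q * r q) * beta_tilde N M \<delta> p q
       + Im (u p * r p) * Im (u q * r q) * beta_tilde N M \<delta> p q)"
    unfolding Re_sum by (intro sum.cong refl) (simp add: algebra_simps del: complex_cnj_mult)
  finally show ?thesis by (simp only: sum.distrib)
qed

text \<open>The spectral bound for real vectors, once for the real and once for the imaginary part
  of the rotated vector; the squared norms of the two add up to that of u.\<close>

lemma vandermonde_form_lower: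
  assumes "N \<ge> 1"
  shows "Min (spectrum (B_tilde N M \<delta>)) * (\<Sum>p=1..N. (cmod (u p))\<^sup>2)
     \<le> vandermonde_form N (\<lambda>p. cis (2 * pi * node_arg M \<delta> p)) u"
proof -
  define r where "r p = cis (- (pi * (real N - 1) * node_arg M \<delta> p))" for p
  have r: "cmod (r p) = 1" for p by (simp add: r_def)
  have N: "N > 0" using assms by simp
  have *: "Min (spectrum (B_tilde N M \<delta>)) * (\<Sum>p=1..N. (a p)\<^sup>2) \<le> (\<Sum>p=1..N. \<Sum>q=1..N. a p * a q * beta_tilde N M \<delta> p q)" for a
    using symmetric_mat_Min_spectrum(2)[OF B_tilde_carrier N B_tilde_sym, of "vec N (\<lambda>i. a (Suc i))"]
    unfolding B_tilde_form scalar_prod_vec_Suc by simp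
  show ?thesis
    unfolding vandermonde_form_eq_B_tilde r_def[symmetric] sum_cmod_unimodular[where r = r and u = u, OF r, symmetric] distrib_left
    by (intro add_mono *)
qed

lemma vandermonde_form_upper:
  assumes "N \<ge> 1"
  shows "vandermonde_form N (\<lambda>p. cis (2 * pi * node_arg M \<delta> p)) u
     \<le> Max (spectrum (B_tilde N M \<delta>)) * (\<Sum>p=1..N. (cmod (u p))\<^sup>2)"
proof -
  define r where "r p = cis (- (pi * (real N - 1) * node_arg M \<delta> p))" for p
  have r: "cmod (r p) = 1" for p by (simp add: r_def)
  have N: "N > 0" using assms by simp
  have *: "(\<Sum>p=1..N. \<Sum>q=1..N. a p * a q * beta_tilde N M \<delta> p q) \<le> Max (spectrum (B_tilde N M \<delta>)) * (\<Sum>p=1..N. (a p)\<^sup>2)" for a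
    using symmetric_mat_Max_spectrum(2)[OF B_tilde_carrier N B_tilde_sym, of "vec N (\<lambda>i. a (Suc i))"]
    unfolding B_tilde_form scalar_prod_vec_Suc by simp
  show ?thesis
    unfolding vandermonde_form_eq_B_tilde r_def[symmetric] sum_cmod_unimodular[where r = r and u = u, OF r, symmetric] distrib_left
    by (intro add_mono *)
qed

text \<open>Sharpness of the two preceding bounds, used for positivity of the minimum and for
  optimality of both constants.\<close>

lemma vandermonde_form_eigenvalue:
  assumes "l \<in> spectrum (B_tilde N M \<delta>)"
  shows "\<exists>u. (\<Sum>p=1..N. (cmod (u p))\<^sup>2) > 0 \<and>
     vandermonde_form N (\<lambda>p. cis (2 * pi * node_arg M \<delta> p)) u = l * (\<Sum>p=1..N. (cmod (u p))\<^sup>2)"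
proof -
  define r where "r p = cis (- (pi * (real N - 1) * node_arg M \<delta> p))" for p
  have r: "cmod (r p) = 1" for p by (simp add: r_def)
  obtain v where v: "v \<in> carrier_vec N" "v \<noteq> 0\<^sub>v N" "B_tilde N M \<delta> *\<^sub>v v = l \<cdot>\<^sub>v v"
    using assms B_tilde_carrier[of N M \<delta>] by (auto simp: spectrum_def eigenvalue_def eigenvector_def)
  \<comment> \<open>The real eigenvector rotated back: u_p * r_p is real, so the imaginary half of
    the form vanishes.\<close>
  define u where "u p = of_real (v $ (p - 1)) * cnj (r p)" for p
  have ur: "u p * r p = of_real (v $ (p - 1))" for p
    using r[of p] by (simp add: u_def mult.assoc mult.commute[of "cnj (r p)"] complex_norm_square[symmetric])
  have vec: "vec N (\<lambda>i. v $ (Suc i - 1)) = v" using v(1) by auto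
  have "vandermonde_form N (\<lambda>p. cis (2 * pi * node_arg M \<delta> p)) u
      = (\<Sum>p=1..N. \<Sum>q=1..N. v $ (p - 1) * v $ (q - 1) * beta_tilde N M \<delta> p q)"
    unfolding vandermonde_form_eq_B_tilde r_def[symmetric] ur by simp
  also have "\<dots> = v \<bullet> (B_tilde N M \<delta> *\<^sub>v v)"
    using B_tilde_form[where N = N and M = M and \<delta> = \<delta> and a = "\<lambda>p. v $ (p - 1)"] unfolding vec by simp
  also have "\<dots> = l * (v \<bullet> v)" using v by simp
  finally have 1: "vandermonde_form N (\<lambda>p. cis (2 * pi * node_arg M \<delta> p)) u = l * (v \<bullet> v)" .
  have "(\<Sum>p=1..N. (cmod (u p))\<^sup>2) = (\<Sum>p=1..N. (v $ (p - 1))\<^sup>2)"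
    unfolding sum_cmod_unimodular[where r = r and u = u, OF r, symmetric] ur by simp
  also have "\<dots> = v \<bullet> v"
    using scalar_prod_vec_Suc[where N = N and a = "\<lambda>p. v $ (p - 1)"] unfolding vec by simp
  finally have 2: "(\<Sum>p=1..N. (cmod (u p))\<^sup>2) = v \<bullet> v" .
  obtain k where k: "k < N" "v $ k \<noteq> 0" using nonzero_vec_index[OF v(1,2)] by blast
  have "v \<bullet> v > 0"
    unfolding scalar_prod_self_eq_sum[OF v(1)] using k by (intro sum_pos2[of _ k]) auto
  with 1 2 show ?thesis by (intro exI[of _ u]) (simp only: simp_thms)
qed

lemma inj_on_nodes: "inj_on (\<lambda>p. cis (2 * pi * node_arg M \<delta> p)) {1..N}"
proof (rule inj_onI, rule ccontr)
  fix p q assume pq: "p \<in> {1..N}" "q \<in> {1..N}" "p \<noteq> q"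
    and eq: "cis (2 * pi * node_arg M \<delta> p) = cis (2 * pi * node_arg M \<delta> q)"
  have "cis (2 * pi * (node_arg M \<delta> p - node_arg M \<delta> q)) = cis (2 * pi * node_arg M \<delta> p) / cis (2 * pi * node_arg M \<delta> q)"
    by (simp add: cis_divide algebra_simps)
  then have "cis (2 * pi * (node_arg M \<delta> p - node_arg M \<delta> q)) = 1" using eq by simp
  then have "cos (2 * pi * (node_arg M \<delta> p - node_arg M \<delta> q)) = 1" by (simp add: complex_eq_iff)
  then obtain k :: int where "2 * pi * (node_arg M \<delta> p - node_arg M \<delta> q) = of_int k * 2 * pi"
    by (auto simp: cos_one_2pi_int)
  then have "node_arg M \<delta> p - node_arg M \<delta> q = of_int k" by simp
  then have "inner (vec_of_int (M p) - vec_of_int (M q)) \<delta> \<in> \<int>"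
    by (simp add: node_arg_def inner_diff_left inner_commute[of \<delta>])
  with noninteger[OF pq] show False by simp
qed

text \<open>The Vandermonde lower bound, evaluated at a vector where the form attains the minimal
  eigenvalue.\<close>

lemma Min_spectrum_B_tilde_pos:
  assumes "N \<ge> 1"
  shows "Min (spectrum (B_tilde N M \<delta>)) > 0"
proof -
  let ?l = "Min (spectrum (B_tilde N M \<delta>))"
  \<comment> \<open>The form contains the conjugated nodes, so these must be distinct.\<close>
  have "inj_on (\<lambda>p. cnj (cis (2 * pi * node_arg M \<delta> p))) {1..N}"
    using inj_on_nodes by (simp only: inj_on_def complex_cnj_cancel_iff)
  from vandermonde_transpose_bounded_below[OF this]
  obtain c where c: "c > 0" "\<And>u. c * (\<Sum>p=1..N. (cmod (u p))\<^sup>2) \<le> vandermonde_form N (\<lambda>p. cis (2 * pi * node_arg M \<delta> p)) u"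
    unfolding vandermonde_form_def by blast
  have "?l \<in> spectrum (B_tilde N M \<delta>)"
    using assms by (intro symmetric_mat_Min_spectrum(1)[OF B_tilde_carrier _ B_tilde_sym]) simp
  then obtain u where u: "(\<Sum>p=1..N. (cmod (u p))\<^sup>2) > 0"
     "vandermonde_form N (\<lambda>p. cis (2 * pi * node_arg M \<delta> p)) u = ?l * (\<Sum>p=1..N. (cmod (u p))\<^sup>2)"
    using vandermonde_form_eigenvalue by blast
  have "c * (\<Sum>p=1..N. (cmod (u p))\<^sup>2) \<le> ?l * (\<Sum>p=1..N. (cmod (u p))\<^sup>2)"
    using c(2)[of u] u(2) by simp
  then have "c \<le> ?l" using u(1) by simp
  with c(1) show ?thesis by simp
qed

end

section \<open>Square-integrable functions\<close>

lemma square_integrable_measurable: "f \<in> square_integrable \<mu> \<Longrightarrow> f \<in> borel_measurable \<mu>"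
  by (simp add: square_integrable_def)

lemma square_integrable_integrable: "f \<in> square_integrable \<mu> \<Longrightarrow> integrable \<mu> (\<lambda>x. (cmod (f x))\<^sup>2)"
  by (simp add: square_integrable_def)

text \<open>Stands in for Minkowski's inequality: distances are measured by integrals of squares
  throughout, where a factor 2 is harmless.\<close>

lemma cmod_add_squared_le: "(cmod (a + b))\<^sup>2 \<le> 2 * (cmod a)\<^sup>2 + 2 * (cmod b)\<^sup>2"
proof -
  have "(cmod (a + b))\<^sup>2 \<le> (cmod a + cmod b)\<^sup>2" by (intro power_mono norm_triangle_ineq) auto
  also have "\<dots> \<le> 2 * (cmod a)\<^sup>2 + 2 * (cmod b)\<^sup>2"
    using sum_squares_bound[of "cmod a" "cmod b"] by (simp add: power2_sum)
  finally show ?thesis .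
qed

lemma square_integrable_dominated:
  assumes "f \<in> borel_measurable \<mu>" "integrable \<mu> g" "\<And>x. x \<in> space \<mu> \<Longrightarrow> (cmod (f x))\<^sup>2 \<le> g x"
  shows "f \<in> square_integrable \<mu>"
  unfolding square_integrable_def
proof (intro CollectI conjI)
  show "integrable \<mu> (\<lambda>x. (cmod (f x))\<^sup>2)"
    using assms by (intro Bochner_Integration.integrable_bound[OF assms(2)] AE_I2) (auto intro: order_trans[OF _ abs_ge_self])
qed fact

lemma square_integrable_bounded:
  assumes "finite_measure \<mu>" "f \<in> borel_measurable \<mu>" "\<And>x. x \<in> space \<mu> \<Longrightarrow> cmod (f x) \<le> B"
  shows "f \<in> square_integrable \<mu>"
proof (rule square_integrable_dominated[OF assms(2)])
  interpret finite_measure \<mu> by fact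
  show "integrable \<mu> (\<lambda>x. B\<^sup>2)" by simp
  show "(cmod (f x))\<^sup>2 \<le> B\<^sup>2" if "x \<in> space \<mu>" for x
    using assms(3)[OF that] by (intro power_mono) auto
qed

lemma square_integrable_cmult:
  assumes "f \<in> square_integrable \<mu>"
  shows "(\<lambda>x. c * f x) \<in> square_integrable \<mu>"
  using assms
  by (auto simp: square_integrable_def norm_mult power_mult_distrib intro: borel_measurable_times)

lemma square_integrable_add:
  assumes "f \<in> square_integrable \<mu>" "g \<in> square_integrable \<mu>"
  shows "(\<lambda>x. f x + g x) \<in> square_integrable \<mu>"
proof (rule square_integrable_dominated)
  show "integrable \<mu> (\<lambda>x. 2 * (cmod (f x))\<^sup>2 + 2 * (cmod (g x))\<^sup>2)"
    using assms by (simp add: square_integrable_def)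
qed (use assms cmod_add_squared_le in \<open>auto simp: square_integrable_def\<close>)

lemma square_integrable_diff:
  assumes "f \<in> square_integrable \<mu>" "g \<in> square_integrable \<mu>"
  shows "(\<lambda>x. f x - g x) \<in> square_integrable \<mu>"
  using square_integrable_add[OF assms(1) square_integrable_cmult[OF assms(2), of "-1"]] by simp

lemma square_integrable_zero: "(\<lambda>x. 0) \<in> square_integrable \<mu>"
  by (simp add: square_integrable_def)

lemma square_integrable_sum:
  assumes "\<And>i. i \<in> I \<Longrightarrow> f i \<in> square_integrable \<mu>"
  shows "(\<lambda>x. \<Sum>i\<in>I. f i x) \<in> square_integrable \<mu>"
  using assms
  by (induction I rule: infinite_finite_induct) (auto intro: square_integrable_add square_integrable_zero)

lemma square_integrable_mult_bounded:
  assumes "f \<in> square_integrable \<mu>" "h \<in> borel_measurable \<mu>" "\<And>x. x \<in> space \<mu> \<Longrightarrow> cmod (h x) \<le> 1"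
  shows "(\<lambda>x. f x * h x) \<in> square_integrable \<mu>"
proof (rule square_integrable_dominated)
  show "integrable \<mu> (\<lambda>x. (cmod (f x))\<^sup>2)" using assms by (simp add: square_integrable_def)
  show "(cmod (f x * h x))\<^sup>2 \<le> (cmod (f x))\<^sup>2" if "x \<in> space \<mu>" for x
    using assms(3)[OF that] by (intro power_mono) (auto simp: norm_mult intro: mult_left_le)
qed (use assms in \<open>auto simp: square_integrable_def\<close>)

lemma integrable_mult_cnj:
  assumes "f \<in> square_integrable \<mu>" "g \<in> square_integrable \<mu>"
  shows "integrable \<mu> (\<lambda>x. f x * cnj (g x))"
proof (rule Bochner_Integration.integrable_bound)
  show "integrable \<mu> (\<lambda>x. (cmod (f x))\<^sup>2 + (cmod (g x))\<^sup>2)"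
    using assms by (simp add: square_integrable_def)
  have [measurable]: "f \<in> borel_measurable \<mu>" "g \<in> borel_measurable \<mu>"
    using assms by (simp_all add: square_integrable_def)
  show "(\<lambda>x. f x * cnj (g x)) \<in> borel_measurable \<mu>"
    by (intro borel_measurable_times measurable_compose[of g \<mu> borel cnj]
        borel_measurable_continuous_onI continuous_intros) auto
  have "a * b \<le> \<bar>a\<^sup>2 + b\<^sup>2\<bar>" for a b :: real
  proof -
    have "2 * (a * b) \<le> a\<^sup>2 + b\<^sup>2" "0 \<le> a\<^sup>2 + b\<^sup>2"
      using sum_squares_bound[of a b] by simp_all
    then show ?thesis by linarith
  qed
  then show "AE x in \<mu>. norm (f x * cnj (g x)) \<le> norm ((cmod (f x))\<^sup>2 + (cmod (g x))\<^sup>2)"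
    by (simp add: norm_mult)
qed

lemma cmod_diff_squared: "(cmod (a - b))\<^sup>2 = (cmod a)\<^sup>2 - 2 * Re (a * cnj b) + (cmod b)\<^sup>2"
  unfolding cmod_power2 by (simp add: power2_eq_square algebra_simps)

section \<open>Fourier series on the unit cube\<close>

lemma vec_of_int_nth [simp]: "vec_nth (vec_of_int n) i = of_int (vec_nth n i)"
  by (simp add: vec_of_int_def)

lemma vec_of_int_add: "vec_of_int (m + n) = vec_of_int m + vec_of_int n"
  by (simp add: vec_of_int_def Finite_Cartesian_Product.vec_eq_iff)

lemma vec_of_int_minus: "vec_of_int (- n) = - vec_of_int n"
  by (simp add: vec_of_int_def Finite_Cartesian_Product.vec_eq_iff)

lemma vec_of_int_zero [simp]: "vec_of_int 0 = 0"
  by (simp add: vec_of_int_def Finite_Cartesian_Product.vec_eq_iff)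

definition fourier_char :: "int ^ 'd \<Rightarrow> real ^ 'd \<Rightarrow> complex" where
  "fourier_char n x = cis (2 * pi * inner (vec_of_int n) x)"

lemma fourier_char_0 [simp]: "fourier_char 0 x = 1"
  by (simp add: fourier_char_def)

lemma fourier_char_add: "fourier_char (m + n) x = fourier_char m x * fourier_char n x"
  by (simp add: fourier_char_def cis_mult vec_of_int_add inner_add_left algebra_simps)

lemma fourier_char_minus: "fourier_char (- n) x = cnj (fourier_char n x)"
  by (simp add: fourier_char_def cis_cnj vec_of_int_minus)

lemma norm_fourier_char [simp]: "cmod (fourier_char n x) = 1"
  by (simp add: fourier_char_def)

lemma continuous_on_fourier_char [continuous_intros]: "continuous_on S (fourier_char n)"
  unfolding fourier_char_def by (intro continuous_intros)

lemma fourier_char_borel [measurable]: "fourier_char n \<in> borel_measurable borel"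
  by (intro borel_measurable_continuous_onI continuous_intros)

lemma unit_cube_borel: "(unit_cube :: (real ^ 'd::finite) set) \<in> sets borel"
proof -
  have "(unit_cube :: (real ^ 'd) set) =
      (\<Inter>i. {x. - (1/2) \<le> vec_nth x i} \<inter> {x. vec_nth x i < 1/2})"
    by (auto simp: unit_cube_def)
  also have "\<dots> \<in> sets borel"
  proof (rule sets.finite_INT[OF finite UNIV_not_empty])
    fix i
    show "{x :: real ^ 'd. - (1/2) \<le> vec_nth x i} \<inter> {x. vec_nth x i < 1/2} \<in> sets borel"
      by (intro sets.Int borel_closed borel_open closed_Collect_le open_Collect_less continuous_intros)
  qed
  finally show ?thesis .
qed

lemma unit_cube_lebesgue: "(unit_cube :: (real ^ 'd::finite) set) \<in> sets lebesgue"
  using unit_cube_borel by (metis sets_completionI_sets sets_lborel)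

lemma bounded_unit_cube: "bounded (unit_cube :: (real ^ 'd::finite) set)"
proof (rule bounded_subset)
  show "bounded (cbox (vec_lambda (\<lambda>i. -1)) (vec_lambda (\<lambda>i. 1)) :: (real ^ 'd) set)" by (rule bounded_cbox)
  show "unit_cube \<subseteq> (cbox (vec_lambda (\<lambda>i. -1)) (vec_lambda (\<lambda>i. 1)) :: (real ^ 'd) set)"
  proof
    fix x :: "real ^ 'd" assume x: "x \<in> unit_cube"
    have "- 1 \<le> vec_nth x i \<and> vec_nth x i \<le> 1" for i
      using x unfolding unit_cube_def by (auto dest!: spec[of _ i])
    then show "x \<in> cbox (vec_lambda (\<lambda>i. -1)) (vec_lambda (\<lambda>i. 1))" by (simp add: mem_box_cart)
  qed
qed

lemma unit_cube_lmeasurable: "(unit_cube :: (real ^ 'd::finite) set) \<in> lmeasurable"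
  using bounded_unit_cube unit_cube_lebesgue by (rule bounded_set_imp_lmeasurable)

lemma finite_measure_unit_cube: "finite_measure (lebesgue_on (unit_cube :: (real ^ 'd::finite) set))"
  by (rule finite_measure_lebesgue_on[OF unit_cube_lmeasurable])

lemma continuous_on_measurable_unit_cube:
  fixes f :: "real ^ 'd::finite \<Rightarrow> 'b::metric_space"
  shows "continuous_on UNIV f \<Longrightarrow> f \<in> borel_measurable (lebesgue_on unit_cube)"
  by (rule continuous_imp_measurable_on_sets_lebesgue[OF continuous_on_subset]) (auto simp: unit_cube_lebesgue)

lemma fourier_char_measurable [measurable]:
  "fourier_char n \<in> borel_measurable (lebesgue_on unit_cube)"
  by (intro continuous_on_measurable_unit_cube continuous_intros)

section \<open>Orthonormality of the characters on the cube\<close>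

lemma borel_measurable_cis_linear: "(\<lambda>t. cis (a * t)) \<in> borel_measurable borel"
  by (intro borel_measurable_continuous_onI continuous_intros)

lemma integral_cis_period:
  "(LINT t|lborel. indicator {- (1/2)..<1/2} t *\<^sub>R cis (2 * pi * of_int k * t)) = (if k = 0 then 1 else 0)"
proof -
  \<comment> \<open>Adding the null endpoint 1/2 gives a closed interval, as the fundamental theorem
    of calculus requires.\<close>
  have "(LINT t|lborel. indicator {- (1/2)..<1/2} t *\<^sub>R cis (2 * pi * of_int k * t))
      = (LINT t|lborel. indicator {- (1/2)..1/2} t *\<^sub>R cis (2 * pi * of_int k * t))"
  proof (rule integral_cong_AE)
    show "AE t in lborel. indicator {- (1/2)..<1/2} t *\<^sub>R cis (2 * pi * of_int k * t)
        = indicator {- (1/2)..1/2::real} t *\<^sub>R cis (2 * pi * of_int k * t)"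
      using AE_lborel_singleton[of "1/2 :: real"] by eventually_elim (auto simp: indicator_def)
  qed (use borel_measurable_cis_linear[of "2 * pi * of_int k"] in simp_all)
  also have "\<dots> = (if k = 0 then 1 else 0)"
  proof (cases "k = 0")
    case True
    have "(LINT t|lborel. indicator {- (1/2)..1/2::real} t *\<^sub>R (1::complex)) = of_real (1/2) - of_real (- (1/2))"
      by (rule integral_FTC_atLeastAtMost) (auto intro!: derivative_eq_intros)
    with True show ?thesis by simp
  next
    case False
    define w where "w = 2 * pi * of_int k * \<i>"
    have w: "w \<noteq> 0" using False by (simp add: w_def)
    have cis: "cis (2 * pi * of_int k * t) = exp (w * of_real t)" for t
      by (simp add: cis_conv_exp w_def mult_ac)
    have "(LINT t|lborel. indicator {- (1/2)..1/2} t *\<^sub>R exp (w * of_real t))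
        = exp (w * of_real (1/2)) / w - exp (w * of_real (- (1/2))) / w"
    proof (rule integral_FTC_atLeastAtMost)
      fix x :: real
      have "((\<lambda>z. exp (w * z) / w) has_field_derivative exp (w * of_real x)) (at (of_real x))"
        using w by (auto intro!: derivative_eq_intros)
      then have "((\<lambda>z. exp (w * of_real z) / w) has_vector_derivative exp (w * of_real x)) (at x)"
        by (rule has_vector_derivative_real_field)
      then show "((\<lambda>z. exp (w * of_real z) / w) has_vector_derivative exp (w * of_real x)) (at x within {- (1/2)..1/2})"
        by (rule has_vector_derivative_at_within)
    qed (auto intro!: continuous_intros)
    \<comment> \<open>The exponents differ by w = 2 pi i k, a whole number of periods.\<close>
    also have "exp (w * of_real (1/2)) = exp (w * of_real (- (1/2)))"
      unfolding exp_eq by (intro exI[of _ k]) (simp add: w_def algebra_simps)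
    finally show ?thesis using False by (simp add: cis)
  qed
  finally show ?thesis .
qed

text \<open>Fubini for a product of functions of single coordinates: \<open>lborel\<close> is the
  image of the product measure indexed by \<open>Basis\<close>.\<close>

lemma integral_lborel_prod:
  fixes f :: "'a::euclidean_space \<Rightarrow> real \<Rightarrow> 'b::{real_normed_field,banach,second_countable_topology}"
  assumes int: "\<And>b. b \<in> Basis \<Longrightarrow> integrable lborel (f b)"
  shows "(LINT x|lborel. (\<Prod>b\<in>Basis. f b (inner x b))) = (\<Prod>b\<in>Basis. LINT t|lborel. f b t)"
proof -
  interpret product_sigma_finite "\<lambda>_::'a. lborel :: real measure" by standard
  have [measurable]: "f b \<in> borel_measurable borel" if "b \<in> Basis" for b
    using borel_measurable_integrable[OF int[OF that]] by simp
  have "(LINT x|lborel. (\<Prod>b\<in>Basis. f b (inner x b)))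
      = (LINT g|(\<Pi>\<^sub>M b\<in>Basis. lborel). (\<Prod>b\<in>Basis. f b (inner (\<Sum>b\<in>Basis. g b *\<^sub>R b) b)))"
    by (subst lborel_eq) (simp add: integral_distr)
  also have "\<dots> = (LINT g|(\<Pi>\<^sub>M b\<in>Basis. lborel). (\<Prod>b\<in>Basis. f b (g b)))"
    by (intro Bochner_Integration.integral_cong prod.cong) auto
  also have "\<dots> = (\<Prod>b\<in>Basis. LINT t|lborel. f b t)"
    by (rule product_integral_prod) (use int in auto)
  finally show ?thesis .
qed

text \<open>Both the indicator of the cube and the character factor over the coordinates, so the
  integral is a product of one-dimensional ones; a single nonzero coordinate of n makes it
  vanish.\<close>

lemma integral_fourier_char:
  "(LINT x|lebesgue_on unit_cube. fourier_char (n :: int ^ 'd::finite) x) = (if n = 0 then 1 else 0)"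
proof -
  let ?g = "\<lambda>b t. indicator {- (1/2)..<1/2} t *\<^sub>R cis (2 * pi * inner (vec_of_int n) b * t)"
  have Basis: "(Basis :: (real ^ 'd) set) = range (\<lambda>i. axis i 1)"
    by (auto simp: Basis_vec_def)
  have "(LINT x|lebesgue_on unit_cube. fourier_char n x)
      = (LINT x|lebesgue. indicator unit_cube x *\<^sub>R fourier_char n x)"
    by (rule integral_restrict_space) (simp add: unit_cube_lebesgue)
  also have "\<dots> = (LINT x|lborel. indicator unit_cube x *\<^sub>R fourier_char n x)"
    by (rule integral_completion) (use unit_cube_borel in measurable)
  also have "\<dots> = (LINT x|lborel. (\<Prod>b\<in>Basis. ?g b (inner x b)))"
  proof (rule Bochner_Integration.integral_cong)
    fix x :: "real ^ 'd"
    have "(\<Prod>b\<in>Basis. cis (2 * pi * inner (vec_of_int n) b * inner x b))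
        = exp (\<Sum>b\<in>Basis. \<i> * of_real (2 * pi * inner (vec_of_int n) b * inner x b))"
      by (simp add: cis_conv_exp exp_sum)
    also have "\<dots> = fourier_char n x"
      unfolding fourier_char_def cis_conv_exp euclidean_inner[of "vec_of_int n" x]
      by (simp add: sum_distrib_left mult_ac)
    finally have "(\<Prod>b\<in>Basis. cis (2 * pi * inner (vec_of_int n) b * inner x b)) = fourier_char n x" .
    moreover have "(\<Prod>b\<in>Basis. indicator {- (1/2)..<1/2} (inner x b) :: real) = indicator unit_cube x"
      by (auto simp: indicator_def unit_cube_def Basis inner_axis intro!: prod.neutral) 
    ultimately show "indicator unit_cube x *\<^sub>R fourier_char n x = (\<Prod>b\<in>Basis. ?g b (inner x b))"
      by (simp add: scaleR_conv_of_real prod.distrib flip: of_real_prod)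
  qed simp
  also have "\<dots> = (\<Prod>b\<in>Basis. LINT t|lborel. ?g b t)"
  proof (rule integral_lborel_prod)
    fix b :: "real ^ 'd"
    have "integrable lborel (\<lambda>t. indicator {- (1/2)..1/2::real} t *\<^sub>R cis (2 * pi * inner (vec_of_int n) b * t))"
      by (intro borel_integrable_compact continuous_intros compact_Icc)
    then show "integrable lborel (?g b)"
      by (rule Bochner_Integration.integrable_bound)
         (use borel_measurable_cis_linear[of "2 * pi * inner (vec_of_int n) b"] in \<open>auto simp: indicator_def\<close>)
  qed
  also have "\<dots> = (\<Prod>b\<in>Basis. if inner (vec_of_int n) b = 0 then 1 else 0)"
  proof (rule prod.cong)
    fix b :: "real ^ 'd" assume "b \<in> Basis"
    then obtain i where "inner (vec_of_int n) b = of_int (vec_nth n i)"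
      by (auto simp: Basis inner_axis)
    then show "(LINT t|lborel. ?g b t) = (if inner (vec_of_int n) b = 0 then 1 else 0)"
      using integral_cis_period[of "vec_nth n i"] by simp
  qed simp
  also have "\<dots> = (if n = 0 then 1 else 0)"
    by (auto simp: Basis inner_axis Finite_Cartesian_Product.vec_eq_iff intro!: prod.neutral prod_zero)
  finally show ?thesis .
qed

section \<open>Trigonometric polynomials and mean-square approximation\<close>

definition trig_polys :: "(real ^ 'd::finite \<Rightarrow> complex) set" where
  "trig_polys = {\<lambda>x. \<Sum>n\<in>F. c n * fourier_char n x | F c. finite F}"

lemma trig_polys_add:
  assumes "f \<in> trig_polys" "g \<in> trig_polys"
  shows "(\<lambda>x. f x + g x) \<in> trig_polys"
proof -
  obtain F c where F: "finite F" "f = (\<lambda>x. \<Sum>n\<in>F. c n * fourier_char n x)"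
    using assms(1) by (auto simp: trig_polys_def)
  obtain G d where G: "finite G" "g = (\<lambda>x. \<Sum>n\<in>G. d n * fourier_char n x)"
    using assms(2) by (auto simp: trig_polys_def)
  define e where "e n = (if n \<in> F then c n else 0) + (if n \<in> G then d n else 0)" for n
  have "f x + g x = (\<Sum>n\<in>F \<union> G. e n * fourier_char n x)" for x
  proof -
    have "f x = (\<Sum>n\<in>F \<union> G. (if n \<in> F then c n else 0) * fourier_char n x)"
      unfolding F(2) using F(1) G(1) by (intro sum.mono_neutral_cong_left) auto
    moreover have "g x = (\<Sum>n\<in>F \<union> G. (if n \<in> G then d n else 0) * fourier_char n x)"
      unfolding G(2) using F(1) G(1) by (intro sum.mono_neutral_cong_left) auto
    ultimately show ?thesis by (simp add: e_def sum.distrib distrib_right)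
  qed
  then show ?thesis using F(1) G(1) unfolding trig_polys_def by blast
qed

lemma trig_polys_monomial: "(\<lambda>x. c * fourier_char n x) \<in> trig_polys"
  unfolding trig_polys_def by (auto intro!: exI[of _ "{n}"] exI[of _ "\<lambda>_. c"])

lemma trig_polys_const: "(\<lambda>x. c) \<in> trig_polys"
  using trig_polys_monomial[of c 0] by simp

lemma trig_polys_sum:
  assumes "\<And>i. i \<in> I \<Longrightarrow> f i \<in> trig_polys"
  shows "(\<lambda>x. \<Sum>i\<in>I. f i x) \<in> trig_polys"
  using assms
  by (induction I rule: infinite_finite_induct) (auto intro: trig_polys_add trig_polys_const)

lemma trig_polys_mult:
  assumes "f \<in> trig_polys" "g \<in> trig_polys"
  shows "(\<lambda>x. f x * g x) \<in> trig_polys"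
proof -
  obtain F c where F: "finite F" "f = (\<lambda>x. \<Sum>n\<in>F. c n * fourier_char n x)"
    using assms(1) by (auto simp: trig_polys_def)
  obtain G d where G: "finite G" "g = (\<lambda>x. \<Sum>n\<in>G. d n * fourier_char n x)"
    using assms(2) by (auto simp: trig_polys_def)
  have "(\<lambda>x. f x * g x) = (\<lambda>x. \<Sum>m\<in>F. \<Sum>n\<in>G. (c m * d n) * fourier_char (m + n) x)"
    unfolding F G by (simp add: sum_product fourier_char_add mult_ac)
  then show ?thesis by (simp add: trig_polys_sum trig_polys_monomial)
qed

lemma fourier_char_square_integrable: "fourier_char n \<in> square_integrable (lebesgue_on unit_cube)"
  by (rule square_integrable_bounded[OF finite_measure_unit_cube fourier_char_measurable, where B = 1]) simp

lemma trig_polys_square_integrable: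
  "f \<in> trig_polys \<Longrightarrow> f \<in> square_integrable (lebesgue_on unit_cube)"
  unfolding trig_polys_def
  by (auto intro!: square_integrable_sum square_integrable_cmult fourier_char_square_integrable)

text \<open>Membership in the closure of the trigonometric polynomials. Square integrability is
  demanded explicitly because the integral of a non-integrable square is 0 by convention, which
  would make the approximation condition trivially true.\<close>

definition trig_approximable :: "(real ^ 'd::finite \<Rightarrow> complex) \<Rightarrow> bool" where
  "trig_approximable g \<longleftrightarrow> g \<in> square_integrable (lebesgue_on unit_cube) \<and>
     (\<forall>\<epsilon>>0. \<exists>p\<in>trig_polys. (LINT x|lebesgue_on unit_cube. (cmod (g x - p x))\<^sup>2) < \<epsilon>)"

lemma integral_cmod_diff_triangle:
  assumes "f \<in> square_integrable \<mu>" "g \<in> square_integrable \<mu>" "h \<in> square_integrable \<mu>"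
  shows "(LINT x|\<mu>. (cmod (f x - h x))\<^sup>2)
     \<le> 2 * (LINT x|\<mu>. (cmod (f x - g x))\<^sup>2) + 2 * (LINT x|\<mu>. (cmod (g x - h x))\<^sup>2)"
proof -
  have [simp]: "integrable \<mu> (\<lambda>x. (cmod (f x - g x))\<^sup>2)" "integrable \<mu> (\<lambda>x. (cmod (g x - h x))\<^sup>2)"
    "integrable \<mu> (\<lambda>x. (cmod (f x - h x))\<^sup>2)"
    using assms by (auto intro!: square_integrable_integrable square_integrable_diff)
  have "(LINT x|\<mu>. (cmod (f x - h x))\<^sup>2)
      \<le> (LINT x|\<mu>. 2 * (cmod (f x - g x))\<^sup>2 + 2 * (cmod (g x - h x))\<^sup>2)"
  proof (rule integral_mono)
    show "(cmod (f x - h x))\<^sup>2 \<le> 2 * (cmod (f x - g x))\<^sup>2 + 2 * (cmod (g x - h x))\<^sup>2" for x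
      using cmod_add_squared_le[of "f x - g x" "g x - h x"] by simp
  qed auto
  then show ?thesis by simp
qed

lemma trig_approximable_closure:
  assumes g: "g \<in> square_integrable (lebesgue_on unit_cube)"
    and approx: "\<And>\<epsilon>. \<epsilon> > 0 \<Longrightarrow> \<exists>h. trig_approximable h \<and>
                    (LINT x|lebesgue_on unit_cube. (cmod (g x - h x))\<^sup>2) < \<epsilon>"
  shows "trig_approximable g"
  unfolding trig_approximable_def
proof (intro conjI allI impI g)
  fix \<epsilon> :: real assume "\<epsilon> > 0"
  \<comment> \<open>Two errors below \<epsilon> / 4, each doubled by
    \<open>integral_cmod_diff_triangle\<close>, add up to less than \<epsilon>.\<close>
  then have e: "\<epsilon> / 4 > 0" by simp
  obtain h where h: "trig_approximable h" "(LINT x|lebesgue_on unit_cube. (cmod (g x - h x))\<^sup>2) < \<epsilon> / 4"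
    using approx[OF e] by blast
  obtain p where p: "p \<in> trig_polys" "(LINT x|lebesgue_on unit_cube. (cmod (h x - p x))\<^sup>2) < \<epsilon> / 4"
    using h(1) e unfolding trig_approximable_def by blast
  have "h \<in> square_integrable (lebesgue_on unit_cube)"
    using h(1) by (simp add: trig_approximable_def)
  from integral_cmod_diff_triangle[OF g this trig_polys_square_integrable[OF p(1)]] h(2) p(2)
  have "(LINT x|lebesgue_on unit_cube. (cmod (g x - p x))\<^sup>2) < \<epsilon>" by linarith
  with p(1) show "\<exists>p\<in>trig_polys. (LINT x|lebesgue_on unit_cube. (cmod (g x - p x))\<^sup>2) < \<epsilon>" by blast
qed

lemma trig_approximable_add:
  assumes f: "trig_approximable f" and g: "trig_approximable g"
  shows "trig_approximable (\<lambda>x. f x + g x)"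
  unfolding trig_approximable_def
proof (intro conjI allI impI)
  let ?\<mu> = "lebesgue_on unit_cube :: (real ^ 'a) measure"
  have sq: "f \<in> square_integrable ?\<mu>" "g \<in> square_integrable ?\<mu>"
    using f g by (simp_all add: trig_approximable_def)
  then show "(\<lambda>x. f x + g x) \<in> square_integrable ?\<mu>" by (rule square_integrable_add)
  fix \<epsilon> :: real assume "\<epsilon> > 0"
  then have e: "\<epsilon> / 4 > 0" by simp
  obtain p where p: "p \<in> trig_polys" "(LINT x|?\<mu>. (cmod (f x - p x))\<^sup>2) < \<epsilon> / 4"
    using f e unfolding trig_approximable_def by blast
  obtain q where q: "q \<in> trig_polys" "(LINT x|?\<mu>. (cmod (g x - q x))\<^sup>2) < \<epsilon> / 4"
    using g e unfolding trig_approximable_def by blast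
  have "(LINT x|?\<mu>. (cmod (f x + g x - (p x + q x)))\<^sup>2)
      \<le> 2 * (LINT x|?\<mu>. (cmod ((f x + g x) - (p x + g x)))\<^sup>2)
       + 2 * (LINT x|?\<mu>. (cmod ((p x + g x) - (p x + q x)))\<^sup>2)"
    by (rule integral_cmod_diff_triangle)
       (intro square_integrable_add sq trig_polys_square_integrable p q)+
  also have "\<dots> < \<epsilon>" using p(2) q(2) by simp
  finally show "\<exists>r\<in>trig_polys. (LINT x|?\<mu>. (cmod (f x + g x - r x))\<^sup>2) < \<epsilon>"
    using trig_polys_add[OF p(1) q(1)] by (intro bexI[of _ "\<lambda>x. p x + q x"]) auto
qed

lemma trig_approximable_cmult:
  assumes f: "trig_approximable f"
  shows "trig_approximable (\<lambda>x. c * f x)"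
  unfolding trig_approximable_def
proof (intro conjI allI impI)
  let ?\<mu> = "lebesgue_on unit_cube :: (real ^ 'a) measure"
  show "(\<lambda>x. c * f x) \<in> square_integrable ?\<mu>" 
    using f by (simp add: trig_approximable_def square_integrable_cmult)
  fix \<epsilon> :: real assume e: "\<epsilon> > 0"
  \<comment> \<open>Adding 1 allows division also when c = 0.\<close>
  let ?C = "(cmod c)\<^sup>2 + 1"
  have C: "?C > 0" by (simp add: add_nonneg_pos)
  obtain p where p: "p \<in> trig_polys" "(LINT x|?\<mu>. (cmod (f x - p x))\<^sup>2) < \<epsilon> / ?C"
    using f e C unfolding trig_approximable_def by (meson divide_pos_pos)
  have "(LINT x|?\<mu>. (cmod (c * f x - c * p x))\<^sup>2) = (cmod c)\<^sup>2 * (LINT x|?\<mu>. (cmod (f x - p x))\<^sup>2)"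
    by (simp flip: right_diff_distrib add: norm_mult power_mult_distrib)
  also have "\<dots> \<le> ?C * (LINT x|?\<mu>. (cmod (f x - p x))\<^sup>2)"
    by (intro mult_right_mono) auto
  also have "\<dots> < \<epsilon>" using p(2) C by (simp add: field_simps)
  finally show "\<exists>r\<in>trig_polys. (LINT x|?\<mu>. (cmod (c * f x - r x))\<^sup>2) < \<epsilon>"
    using trig_polys_mult[OF trig_polys_const p(1)] by (intro bexI[of _ "\<lambda>x. c * p x"]) auto
qed

lemma trig_approximable_zero: "trig_approximable (\<lambda>x. 0)"
  unfolding trig_approximable_def
  using square_integrable_zero by (auto intro!: bexI[OF _ trig_polys_const[of 0]])

lemma trig_approximable_sum:
  assumes "\<And>i. i \<in> I \<Longrightarrow> trig_approximable (f i)"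
  shows "trig_approximable (\<lambda>x. \<Sum>i\<in>I. f i x)"
  using assms
  by (induction I rule: infinite_finite_induct) (auto intro: trig_approximable_add trig_approximable_zero)

section \<open>Density of trigonometric polynomials via the torus\<close>

definition torus_map :: "real ^ 'd::finite \<Rightarrow> complex ^ 'd" where
  "torus_map x = vec_lambda (\<lambda>i. fourier_char (axis i 1) x)"

lemma fourier_char_axis: "fourier_char (axis i 1) x = cis (2 * pi * vec_nth x i)"
proof -
  have "vec_of_int (axis i 1) = axis i 1"
    by (simp add: Finite_Cartesian_Product.vec_eq_iff axis_def)
  then show ?thesis by (simp add: fourier_char_def inner_axis')
qed

lemma continuous_on_torus_map: "continuous_on S torus_map"
  unfolding torus_map_def by (intro continuous_intros)

text \<open>Equal values force an integer difference, and points of a half-open interval of length 1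
  differ by less than 1.\<close>

lemma cis_inj_half_open:
  assumes "cis (2 * pi * a) = cis (2 * pi * b)" "- (1/2) \<le> a" "a < 1/2" "- (1/2) \<le> b" "b < 1/2"
  shows "a = b"
proof -
  have "exp (\<i> * of_real (2 * pi * a)) = exp (\<i> * of_real (2 * pi * b))"
    using assms(1) by (simp add: cis_conv_exp)
  then obtain k :: int where "\<i> * of_real (2 * pi * a) = \<i> * of_real (2 * pi * b) + of_int (2 * k) * pi * \<i>"
    unfolding exp_eq by blast
  then have "\<i> * of_real (2 * pi * a) = \<i> * of_real (2 * pi * b + 2 * pi * of_int k)"
    by (simp add: algebra_simps)
  then have "2 * pi * a = 2 * pi * b + 2 * pi * of_int k"
    by (simp only: mult_cancel_left of_real_eq_iff) simp
  then have "2 * pi * (a - b - of_int k) = 0" by (simp add: algebra_simps)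
  then have k: "a = b + of_int k" by simp
  with assms(2-) have "of_int k < (1::real)" "of_int k > (-1::real)" by linarith+
  then have "k = 0" by linarith
  with k show ?thesis by simp
qed

lemma inj_on_torus_map: "inj_on torus_map unit_cube"
proof (rule inj_onI)
  fix x y :: "real ^ 'd" assume "x \<in> unit_cube" "y \<in> unit_cube" "torus_map x = torus_map y"
  then have "vec_nth x i = vec_nth y i" for i
    by (intro cis_inj_half_open)
       (auto simp: torus_map_def unit_cube_def Finite_Cartesian_Product.vec_eq_iff fourier_char_axis)
  then show "x = y" by (simp add: Finite_Cartesian_Product.vec_eq_iff)
qed

text \<open>Stone-Weierstrass for the real algebra of continuous functions on the torus that pull
  back to trigonometric polynomials. Points are separated by the real and imaginary parts of their
  coordinates, which combine the characters of frequencies \<open>axis i 1\<close> and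
  \<open>- axis i 1\<close>.\<close>

lemma trig_poly_uniform_approx:
  fixes h :: "complex ^ 'd::finite \<Rightarrow> real"
  assumes "continuous_on UNIV h" "\<epsilon> > 0"
  shows "\<exists>p\<in>trig_polys. \<forall>x\<in>unit_cube. cmod (of_real (h (torus_map x)) - p x) < \<epsilon>"
proof -
  \<comment> \<open>The closure supplies compactness. Gluing of opposite faces is harmless, since
    separation of points is checked in the image.\<close>
  let ?T = "torus_map ` closure unit_cube :: (complex ^ 'd) set"
  let ?P = "\<lambda>f. continuous_on ?T f \<and> (\<lambda>x. of_real (f (torus_map x))) \<in> trig_polys"
  have "\<exists>g. ?P g \<and> (\<forall>z\<in>?T. \<bar>h z - g z\<bar> < \<epsilon>)"
  proof (rule Stone_Weierstrass_HOL)
    show "compact ?T"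
      using bounded_unit_cube by (intro compact_continuous_image continuous_on_torus_map) (simp add: compact_closure)
    show "continuous_on ?T h" using assms(1) by (rule continuous_on_subset) auto
    show "?P (\<lambda>z. c)" for c by (simp add: trig_polys_const)
    show "?P (\<lambda>x. f x + g x)" if "?P f \<and> ?P g" for f g
      using that trig_polys_add by (auto intro!: continuous_intros)
    show "?P (\<lambda>x. f x * g x)" if "?P f \<and> ?P g" for f g
      using that trig_polys_mult by (auto intro!: continuous_intros)
    show "\<exists>f. ?P f \<and> f z \<noteq> f w" if zw: "z \<in> ?T \<and> w \<in> ?T \<and> z \<noteq> w" for z w
    proof -
      obtain i where "vec_nth z i \<noteq> vec_nth w i"
        using zw by (auto simp: Finite_Cartesian_Product.vec_eq_iff)
      then have ne: "Re (vec_nth z i) \<noteq> Re (vec_nth w i) \<or> Im (vec_nth z i) \<noteq> Im (vec_nth w i)"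
        by (auto simp: complex_eq_iff)
      let ?e = "fourier_char (axis i 1) :: real ^ 'd \<Rightarrow> complex" and ?e' = "fourier_char (- axis i 1) :: real ^ 'd \<Rightarrow> complex"
      have "of_real (Re u) = 1/2 * u + 1/2 * cnj u" "of_real (Im u) = (- \<i>/2) * u + (\<i>/2) * cnj u" for u
        by (simp_all add: complex_eq_iff)
      then have "(\<lambda>x. of_real (Re (vec_nth (torus_map x) i))) = (\<lambda>x. 1/2 * ?e x + 1/2 * ?e' x)"
        "(\<lambda>x. of_real (Im (vec_nth (torus_map x) i))) = (\<lambda>x. (- \<i>/2) * ?e x + (\<i>/2) * ?e' x)"
        by (simp_all add: torus_map_def fourier_char_minus)
      then have "(\<lambda>x :: real ^ 'd. of_real (Re (vec_nth (torus_map x) i))) \<in> trig_polys"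
          "(\<lambda>x :: real ^ 'd. of_real (Im (vec_nth (torus_map x) i))) \<in> trig_polys"
        by (simp_all only: trig_polys_add trig_polys_monomial)
      then have "?P (\<lambda>z. Re (vec_nth z i))" "?P (\<lambda>z. Im (vec_nth z i))"
        by (auto intro!: continuous_intros)
      with ne show ?thesis by blast
    qed
  qed (use assms in auto)
  then obtain g where g: "(\<lambda>x. of_real (g (torus_map x))) \<in> trig_polys" "\<And>z. z \<in> ?T \<Longrightarrow> \<bar>h z - g z\<bar> < \<epsilon>"
    by blast
  have "cmod (of_real (h (torus_map x)) - of_real (g (torus_map x))) < \<epsilon>" if "x \<in> unit_cube" for x :: "real ^ 'd"
    using g(2)[of "torus_map x"] that closure_subset by (auto simp flip: of_real_diff)
  then show ?thesis using g(1) by (intro bexI[of _ "\<lambda>x. of_real (g (torus_map x))"]) auto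
qed

lemma trig_approximable_continuous:
  fixes h :: "complex ^ 'd::finite \<Rightarrow> real"
  assumes h: "continuous_on UNIV h" and B: "\<And>z. \<bar>h z\<bar> \<le> B"
  shows "trig_approximable (\<lambda>x. of_real (h (torus_map x)))"
proof -
  let ?\<mu> = "lebesgue_on unit_cube :: (real ^ 'd) measure"
  let ?f = "\<lambda>x. of_real (h (torus_map x)) :: complex"
  interpret finite_measure ?\<mu> by (rule finite_measure_unit_cube)
  have "?f \<in> borel_measurable ?\<mu>"
    by (intro continuous_on_measurable_unit_cube continuous_intros continuous_on_compose2[OF h] continuous_on_torus_map) auto
  then have f: "?f \<in> square_integrable ?\<mu>"
    by (rule square_integrable_bounded[OF finite_measure_unit_cube, of _ B]) (use B in auto)
  show ?thesis unfolding trig_approximable_def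
  proof (intro conjI allI impI f)
    fix \<epsilon> :: real assume e: "\<epsilon> > 0"
    \<comment> \<open>One more than the volume, so that a squared error of \<epsilon> / m integrates
      to strictly less than \<epsilon>.\<close>
    define m where "m = measure ?\<mu> (space ?\<mu>) + 1"
    have m: "m > 0" by (simp add: m_def add_nonneg_pos)
    define d where "d = sqrt (\<epsilon> / m)"
    have d: "d > 0" "d\<^sup>2 = \<epsilon> / m" using e m by (simp_all add: d_def)
    obtain p where p: "p \<in> trig_polys" "\<And>x. x \<in> unit_cube \<Longrightarrow> cmod (?f x - p x) < d"
      using trig_poly_uniform_approx[OF h d(1)] by blast
    have "(LINT x|?\<mu>. (cmod (?f x - p x))\<^sup>2) \<le> (LINT x|?\<mu>. d\<^sup>2)"
    proof (rule integral_mono)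
      show "integrable ?\<mu> (\<lambda>x. (cmod (?f x - p x))\<^sup>2)"
        by (intro square_integrable_integrable square_integrable_diff f trig_polys_square_integrable p)
      show "(cmod (?f x - p x))\<^sup>2 \<le> d\<^sup>2" if "x \<in> space ?\<mu>" for x
        using p(2)[of x] that by (intro power_mono) auto
    qed simp
    also have "\<dots> = (m - 1) * (\<epsilon> / m)" by (simp add: m_def d(2))
    also have "\<dots> < \<epsilon>" using m e by (simp add: field_simps)
    finally show "\<exists>p\<in>trig_polys. (LINT x|?\<mu>. (cmod (?f x - p x))\<^sup>2) < \<epsilon>" using p(1) by blast
  qed
qed

lemma trig_approximable_pointwise_limit:
  assumes g: "g \<in> square_integrable (lebesgue_on unit_cube)"
    and s: "\<And>k. trig_approximable (s k)"
    and lim: "\<And>x. x \<in> unit_cube \<Longrightarrow> (\<lambda>k. s k x) \<longlonglongrightarrow> g x"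
    and dom: "integrable (lebesgue_on unit_cube) w" "\<And>k x. x \<in> unit_cube \<Longrightarrow> (cmod (g x - s k x))\<^sup>2 \<le> w x"
  shows "trig_approximable g"
proof (rule trig_approximable_closure[OF g])
  fix \<epsilon> :: real assume e: "\<epsilon> > 0"
  let ?\<mu> = "lebesgue_on unit_cube :: (real ^ 'a) measure"
  have "(\<lambda>k. LINT x|?\<mu>. (cmod (g x - s k x))\<^sup>2) \<longlonglongrightarrow> (LINT x|?\<mu>. 0)"
  proof (rule integral_dominated_convergence)
    show "(\<lambda>x. (cmod (g x - s k x))\<^sup>2) \<in> borel_measurable ?\<mu>" for k
      using square_integrable_diff[OF g] s[of k] square_integrable_integrable
      unfolding trig_approximable_def by blast
    show "AE x in ?\<mu>. (\<lambda>k. (cmod (g x - s k x))\<^sup>2) \<longlonglongrightarrow> 0"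
    proof (rule AE_I2)
      fix x assume "x \<in> space ?\<mu>"
      then have "(\<lambda>k. (cmod (g x - s k x))\<^sup>2) \<longlonglongrightarrow> (cmod (g x - g x))\<^sup>2"
        using lim[of x] by (intro tendsto_intros) auto
      then show "(\<lambda>k. (cmod (g x - s k x))\<^sup>2) \<longlonglongrightarrow> 0" by simp
    qed
    show "AE x in ?\<mu>. norm ((cmod (g x - s k x))\<^sup>2) \<le> w x" for k
      using dom(2) by (intro AE_I2) auto
  qed (use dom in auto)
  then have "\<forall>\<^sub>F k in sequentially. (LINT x|?\<mu>. (cmod (g x - s k x))\<^sup>2) < \<epsilon>"
    by (rule order_tendstoD(2)) (simp add: e)
  then obtain k where "(LINT x|?\<mu>. (cmod (g x - s k x))\<^sup>2) < \<epsilon>"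
    by (auto simp: eventually_sequentially)
  then show "\<exists>h. trig_approximable h \<and> (LINT x|?\<mu>. (cmod (g x - h x))\<^sup>2) < \<epsilon>"
    using s by blast
qed

text \<open>Tent functions of the distance to the image C of K on the torus. C is closed since K is
  compact, and injectivity of \<open>torus_map\<close> on the cube keeps every other point of the
  cube out of C. So the distance is positive exactly off K.\<close>

lemma trig_approximable_indicator_compact:
  fixes K :: "(real ^ 'd::finite) set"
  assumes K: "compact K" "K \<subseteq> unit_cube"
  shows "trig_approximable (indicator K)"
\<comment> \<open>\<open>infdist\<close> to the empty set is 0, so the tents would be constantly 1
  there.\<close>
proof (cases "K = {}")
  case True
  then have "(indicator K :: _ \<Rightarrow> complex) = (\<lambda>x. 0)" by (simp add: fun_eq_iff)
  then show ?thesis using trig_approximable_zero by simp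
next
  case False
  let ?\<mu> = "lebesgue_on unit_cube :: (real ^ 'd) measure"
  interpret finite_measure ?\<mu> by (rule finite_measure_unit_cube)
  define C where "C = torus_map ` K"
  have C: "closed C" "C \<noteq> {}"
    using compact_continuous_image[OF continuous_on_torus_map K(1)] False
    by (auto simp: C_def compact_imp_closed)
  define h where "h k z = max 0 (1 - real k * infdist z C)" for k z
  have h01: "0 \<le> h k z" "h k z \<le> 1" for k z
    by (auto simp: h_def infdist_nonneg)
  have Kmeas: "K \<in> sets ?\<mu>"
    using K by (simp add: sets_restrict_space_iff unit_cube_lebesgue borel_compact)
  have "(indicator K :: _ \<Rightarrow> complex) \<in> borel_measurable ?\<mu>"
    using Kmeas by simp
  then have ind: "(indicator K :: _ \<Rightarrow> complex) \<in> square_integrable ?\<mu>"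
    by (rule square_integrable_bounded[OF finite_measure_unit_cube, of _ 1]) (auto simp: indicator_def)
  show ?thesis
  proof (rule trig_approximable_pointwise_limit[OF ind, of "\<lambda>k x. of_real (h k (torus_map x))" "\<lambda>_. 1"])
    show "trig_approximable (\<lambda>x. of_real (h k (torus_map x)))" for k
    proof (rule trig_approximable_continuous)
      show "continuous_on UNIV (h k)" unfolding h_def by (intro continuous_intros)
      show "\<bar>h k z\<bar> \<le> 1" for z using h01[of k z] by simp
    qed
    fix x :: "real ^ 'd" assume x: "x \<in> unit_cube"
    have iff: "torus_map x \<in> C \<longleftrightarrow> x \<in> K"
      unfolding C_def using inj_on_image_mem_iff[OF inj_on_torus_map x K(2)] .
    show "(\<lambda>k. of_real (h k (torus_map x)) :: complex) \<longlonglongrightarrow> indicator K x"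
    proof (cases "x \<in> K")
      case True
      then have "h k (torus_map x) = 1" for k using iff C by (simp add: h_def)
      with True show ?thesis by simp
    next
      case False
      then have pos: "infdist (torus_map x) C > 0"
        using iff C by (simp add: infdist_pos_not_in_closed)
      \<comment> \<open>Beyond this index the tent has width below the distance to C, so it vanishes
        at the point.\<close>
      obtain k0 :: nat where k0: "1 / infdist (torus_map x) C < real k0" using reals_Archimedean2 by blast
      have "h k (torus_map x) = 0" if "k \<ge> k0" for k
      proof -
        have "1 / infdist (torus_map x) C \<le> real k" using k0 that by linarith
        then show ?thesis using pos by (simp add: h_def field_simps)
      qed
      then have "\<forall>\<^sub>F k in sequentially. of_real (h k (torus_map x)) = (0 :: complex)"
        by (auto intro: eventually_sequentiallyI)
      with False show ?thesis by (simp add: tendsto_eventually)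
    qed
    fix k
    have "indicator K x - of_real (h k (torus_map x)) = (of_real (indicator K x - h k (torus_map x)) :: complex)"
      by (simp add: indicator_def)
    then have "cmod (indicator K x - of_real (h k (torus_map x))) \<le> 1"
      using h01[of k "torus_map x"] by (simp only: norm_of_real) (auto simp: indicator_def)
    then show "(cmod (indicator K x - of_real (h k (torus_map x))))\<^sup>2 \<le> 1"
      by (simp add: power_le_one)
  qed simp
qed

text \<open>Inner regularity: a closed subset of the bounded cube is compact, and the squared error
  is the measure of what it misses.\<close>

lemma trig_approximable_indicator:
  fixes S :: "(real ^ 'd::finite) set"
  assumes S: "S \<in> sets (lebesgue_on unit_cube)"
  shows "trig_approximable (indicator S)"
proof (rule trig_approximable_closure)
  let ?\<mu> = "lebesgue_on unit_cube :: (real ^ 'd) measure"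
  have S': "S \<in> sets lebesgue" "S \<subseteq> unit_cube"
    using S by (auto simp: sets_restrict_space_iff unit_cube_lebesgue)
  show "indicator S \<in> square_integrable ?\<mu>"
    by (rule square_integrable_bounded[OF finite_measure_unit_cube, of _ 1]) (use S in \<open>auto simp: indicator_def\<close>)
  fix \<epsilon> :: real assume e: "\<epsilon> > 0"
  obtain T where T: "closed T" "T \<subseteq> S" "S - T \<in> lmeasurable" "emeasure lebesgue (S - T) < ennreal \<epsilon>"
    using sets_lebesgue_inner_closed[OF S'(1) e] by blast
  have "compact T" using T S'(2) bounded_unit_cube by (meson bounded_subset compact_eq_bounded_closed)
  then have "trig_approximable (indicator T)"
    using T(2) S'(2) by (intro trig_approximable_indicator_compact) auto
  moreover have "(LINT x|?\<mu>. (cmod (indicator S x - indicator T x))\<^sup>2) < \<epsilon>"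
  proof -
    have ST: "S - T \<in> sets ?\<mu>"
      using T S' by (simp add: sets_restrict_space_iff unit_cube_lebesgue fmeasurableD le_infI1 Diff_subset_conv sup.coboundedI2)
    have "(LINT x|?\<mu>. (cmod (indicator S x - indicator T x))\<^sup>2) = (LINT x|?\<mu>. indicator (S - T) x)"
      by (rule Bochner_Integration.integral_cong) (use T(2) in \<open>auto simp: indicator_def\<close>)
    also have "\<dots> = measure ?\<mu> (S - T)"
      using S'(2) by (simp add: Int_absorb2 Diff_subset_conv sup.coboundedI2)
    also have "\<dots> = measure lebesgue (S - T)"
      by (rule measure_restrict_space) (use S' unit_cube_lebesgue in auto)
    also have "\<dots> < \<epsilon>"
      using T(4) by (simp add: emeasure_eq_measure2[OF T(3)] ennreal_less_iff)
    finally show ?thesis .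
  qed
  ultimately show "\<exists>h. trig_approximable h \<and> (LINT x|?\<mu>. (cmod (indicator S x - h x))\<^sup>2) < \<epsilon>" by blast
qed

lemma trig_approximable_square_integrable:
  fixes g :: "real ^ 'd::finite \<Rightarrow> complex"
  assumes g: "g \<in> square_integrable (lebesgue_on unit_cube)"
  shows "trig_approximable g"
proof -
  let ?\<mu> = "lebesgue_on unit_cube :: (real ^ 'd) measure"
  interpret finite_measure ?\<mu> by (rule finite_measure_unit_cube)
  obtain s where s: "\<And>k. simple_function ?\<mu> (s k)"
    "\<And>x. x \<in> space ?\<mu> \<Longrightarrow> (\<lambda>k. s k x) \<longlonglongrightarrow> g x"
    "\<And>k x. x \<in> space ?\<mu> \<Longrightarrow> dist (s k x) 0 \<le> 2 * dist (g x) 0"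
    using borel_measurable_implies_sequence_metric[OF square_integrable_measurable[OF g], of 0] by metis
  \<comment> \<open>The simple function \<open>s k\<close> written out as a finite combination of
    indicators, to which linearity of approximability applies; it agrees with \<open>s k\<close> on
    the cube.\<close>
  define t where "t k x = (\<Sum>y\<in>s k ` space ?\<mu>. y * indicator (s k -` {y} \<inter> space ?\<mu>) x)" for k x
  have ts: "t k x = s k x" if "x \<in> unit_cube" for k x
  proof -
    have "t k x = (\<Sum>y\<in>s k ` space ?\<mu>. if y = s k x then y else 0)"
      unfolding t_def by (intro sum.cong) (use that in \<open>auto simp: indicator_def\<close>)
    also have "\<dots> = s k x"
      using simple_functionD(1)[OF s(1)[of k]] that by simp
    finally show ?thesis .
  qed
  show ?thesis
  proof (rule trig_approximable_pointwise_limit[OF g, of t "\<lambda>x. 9 * (cmod (g x))\<^sup>2"])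
    show "trig_approximable (t k)" for k
      unfolding t_def
      by (intro trig_approximable_sum trig_approximable_cmult trig_approximable_indicator
            simple_functionD(2)[OF s(1)])
    show "integrable ?\<mu> (\<lambda>x. 9 * (cmod (g x))\<^sup>2)" using square_integrable_integrable[OF g] by simp
    fix x :: "real ^ 'd" assume x: "x \<in> unit_cube"
    then show "(\<lambda>k. t k x) \<longlonglongrightarrow> g x" using s(2)[of x] by (simp add: ts)
    fix k
    \<comment> \<open>3 = 1 + 2, from the domination of \<open>s k\<close> by twice the modulus of
      g; the square gives the 9 in the majorant.\<close>
    have "cmod (g x - t k x) \<le> 3 * cmod (g x)"
      using s(3)[of x k] x norm_triangle_ineq4[of "g x" "t k x"] by (simp add: ts)
    then have "(cmod (g x - t k x))\<^sup>2 \<le> (3 * cmod (g x))\<^sup>2" by (intro power_mono) auto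
    then show "(cmod (g x - t k x))\<^sup>2 \<le> 9 * (cmod (g x))\<^sup>2" by (simp add: power_mult_distrib)
  qed
qed

section \<open>Parseval's identity\<close>

lemma L2_inner_fourier_char:
  "L2_inner (lebesgue_on unit_cube) (fourier_char m) (fourier_char n) = (if m = n then 1 else 0)"
  using integral_fourier_char[of "m - n"]
  by (simp add: L2_inner_def flip: fourier_char_minus fourier_char_add)

lemma integral_cmod_diff_squared:
  assumes f: "f \<in> square_integrable \<mu>" and g: "g \<in> square_integrable \<mu>"
  shows "(LINT x|\<mu>. (cmod (f x - g x))\<^sup>2)
      = (LINT x|\<mu>. (cmod (f x))\<^sup>2) - 2 * Re (LINT x|\<mu>. f x * cnj (g x)) + (LINT x|\<mu>. (cmod (g x))\<^sup>2)"
proof -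
  define h where "h = (\<lambda>x. f x * cnj (g x))"
  have h: "integrable \<mu> h" unfolding h_def by (rule integrable_mult_cnj[OF f g])
  have "(LINT x|\<mu>. (cmod (f x - g x))\<^sup>2) = (LINT x|\<mu>. (cmod (f x))\<^sup>2 - 2 * Re (h x) + (cmod (g x))\<^sup>2)"
    by (simp only: cmod_diff_squared h_def)
  also have "\<dots> = (LINT x|\<mu>. (cmod (f x))\<^sup>2) - 2 * Re (LINT x|\<mu>. h x) + (LINT x|\<mu>. (cmod (g x))\<^sup>2)"
    using square_integrable_integrable[OF f] square_integrable_integrable[OF g] h by simp
  finally show ?thesis unfolding h_def .
qed

text \<open>Completing the square by orthonormality. The choice c = a gives Bessel's inequality,
  dropping the last sum bounds the error of every polynomial from below, and g = 0 gives the norm of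
  a trigonometric polynomial.\<close>

lemma integral_cmod_diff_trig_poly:
  fixes g :: "real ^ 'd::finite \<Rightarrow> complex"
  assumes g: "g \<in> square_integrable (lebesgue_on unit_cube)" and F: "finite F"
  defines "a \<equiv> \<lambda>n. L2_inner (lebesgue_on unit_cube) g (fourier_char n)"
  shows "(LINT x|lebesgue_on unit_cube. (cmod (g x - (\<Sum>n\<in>F. c n * fourier_char n x)))\<^sup>2)
      = (LINT x|lebesgue_on unit_cube. (cmod (g x))\<^sup>2) - (\<Sum>n\<in>F. (cmod (a n))\<^sup>2) + (\<Sum>n\<in>F. (cmod (a n - c n))\<^sup>2)"
proof -
  let ?\<mu> = "lebesgue_on unit_cube :: (real ^ 'd) measure"
  let ?p = "\<lambda>x. \<Sum>n\<in>F. c n * fourier_char n x"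
  have p: "?p \<in> square_integrable ?\<mu>"
    by (intro square_integrable_sum square_integrable_cmult fourier_char_square_integrable)
  have inner_p: "(LINT x|?\<mu>. f x * cnj (?p x)) = (\<Sum>n\<in>F. cnj (c n) * L2_inner ?\<mu> f (fourier_char n))"
    if f: "f \<in> square_integrable ?\<mu>" for f
  proof -
    have "(LINT x|?\<mu>. f x * cnj (?p x)) = (LINT x|?\<mu>. (\<Sum>n\<in>F. cnj (c n) * (f x * cnj (fourier_char n x))))"
      by (intro Bochner_Integration.integral_cong) (simp_all add: sum_distrib_left mult_ac)
    also have "\<dots> = (\<Sum>n\<in>F. cnj (c n) * L2_inner ?\<mu> f (fourier_char n))"
      unfolding L2_inner_def
      by (subst Bochner_Integration.integral_sum)
         (auto intro!: integrable_mult_cnj f fourier_char_square_integrable)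
    finally show ?thesis .
  qed
  have pp: "(LINT x|?\<mu>. (cmod (?p x))\<^sup>2) = (\<Sum>n\<in>F. (cmod (c n))\<^sup>2)"
  proof -
    have "L2_inner ?\<mu> ?p (fourier_char n) = (if n \<in> F then c n else 0)" for n
    proof -
      have "L2_inner ?\<mu> ?p (fourier_char n)
          = (LINT x|?\<mu>. (\<Sum>m\<in>F. c m * (fourier_char m x * cnj (fourier_char n x))))"
        unfolding L2_inner_def by (intro Bochner_Integration.integral_cong) (simp_all add: sum_distrib_right mult.assoc)
      also have "\<dots> = (\<Sum>m\<in>F. c m * L2_inner ?\<mu> (fourier_char m) (fourier_char n))"
        unfolding L2_inner_def
        by (subst Bochner_Integration.integral_sum)
           (auto intro!: integrable_mult_cnj fourier_char_square_integrable)
      also have "\<dots> = (if n \<in> F then c n else 0)"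
        using F by (simp add: L2_inner_fourier_char if_distrib cong: if_cong)
      finally show ?thesis .
    qed
    then have "(LINT x|?\<mu>. ?p x * cnj (?p x)) = (\<Sum>n\<in>F. cnj (c n) * c n)"
      unfolding inner_p[OF p] by (intro sum.cong) auto
    also have "\<dots> = of_real (\<Sum>n\<in>F. (cmod (c n))\<^sup>2)"
      by (simp only: of_real_sum complex_norm_square mult.commute)
    finally have "(LINT x|?\<mu>. of_real ((cmod (?p x))\<^sup>2)) = (of_real (\<Sum>n\<in>F. (cmod (c n))\<^sup>2) :: complex)"
      by (simp only: complex_norm_square)
    then show ?thesis by (simp only: integral_complex_of_real of_real_eq_iff)
  qed
  have "(LINT x|?\<mu>. (cmod (g x - ?p x))\<^sup>2)
      = (LINT x|?\<mu>. (cmod (g x))\<^sup>2) - 2 * Re (LINT x|?\<mu>. g x * cnj (?p x)) + (LINT x|?\<mu>. (cmod (?p x))\<^sup>2)"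
    by (rule integral_cmod_diff_squared[OF g p])
  also have "\<dots> = (LINT x|?\<mu>. (cmod (g x))\<^sup>2) - (\<Sum>n\<in>F. 2 * Re (cnj (c n) * a n)) + (\<Sum>n\<in>F. (cmod (c n))\<^sup>2)"
    unfolding inner_p[OF g] pp a_def by (simp add: sum_distrib_left)
  also have "(\<Sum>n\<in>F. 2 * Re (cnj (c n) * a n)) = (\<Sum>n\<in>F. (cmod (a n))\<^sup>2 + (cmod (c n))\<^sup>2 - (cmod (a n - c n))\<^sup>2)"
    by (intro sum.cong) (simp_all add: cmod_diff_squared mult.commute)
  finally show ?thesis by (simp add: sum.distrib sum_subtractf)
qed

lemma integral_cmod_trig_poly:
  fixes c :: "int ^ 'd::finite \<Rightarrow> complex"
  assumes F: "finite F"
  shows "(LINT x|lebesgue_on unit_cube. (cmod (\<Sum>n\<in>F. c n * fourier_char n x))\<^sup>2) = (\<Sum>n\<in>F. (cmod (c n))\<^sup>2)"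
  using integral_cmod_diff_trig_poly[OF square_integrable_zero F, of c]
  by (simp add: L2_inner_def)

text \<open>Bessel bounds all partial sums by the integral. Conversely a polynomial with error below
  \<epsilon> has a finite frequency set whose partial sum misses the integral by less than
  \<epsilon>, since the true coefficients approximate at least as well.\<close>

theorem fourier_parseval:
  fixes g :: "real ^ 'd::finite \<Rightarrow> complex"
  assumes g: "g \<in> square_integrable (lebesgue_on unit_cube)"
  shows "((\<lambda>n. (cmod (L2_inner (lebesgue_on unit_cube) g (fourier_char n)))\<^sup>2)
            has_sum (LINT x|lebesgue_on unit_cube. (cmod (g x))\<^sup>2)) UNIV"
proof -
  let ?\<mu> = "lebesgue_on unit_cube :: (real ^ 'd) measure"
  let ?a = "\<lambda>n. (cmod (L2_inner ?\<mu> g (fourier_char n)))\<^sup>2"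
  let ?I = "LINT x|?\<mu>. (cmod (g x))\<^sup>2"
  have bessel: "sum ?a F \<le> ?I" if "finite F" for F
  proof -
    have "0 \<le> (LINT x|?\<mu>. (cmod (g x - (\<Sum>n\<in>F. L2_inner ?\<mu> g (fourier_char n) * fourier_char n x)))\<^sup>2)"
      by (intro integral_nonneg_AE) auto
    then show ?thesis unfolding integral_cmod_diff_trig_poly[OF g that] by simp
  qed
  have sup: "(?a has_sum (SUP F\<in>{F. F \<subseteq> UNIV \<and> finite F}. sum ?a F)) UNIV"
    by (rule nonneg_bounded_partial_sums_imp_has_sum_SUP[where C = ?I])
       (auto simp: bessel intro: eventually_finite_subsets_at_top_weakI)
  have "(SUP F\<in>{F. F \<subseteq> UNIV \<and> finite F}. sum ?a F) = ?I"
  proof (rule antisym)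
    show "(SUP F\<in>{F. F \<subseteq> UNIV \<and> finite F}. sum ?a F) \<le> ?I"
      by (rule cSUP_least) (auto simp: bessel)
    show "?I \<le> (SUP F\<in>{F. F \<subseteq> UNIV \<and> finite F}. sum ?a F)"
    proof (rule field_le_epsilon)
      fix \<epsilon> :: real assume "\<epsilon> > 0"
      then obtain p where "p \<in> trig_polys" "(LINT x|?\<mu>. (cmod (g x - p x))\<^sup>2) < \<epsilon>"
        using trig_approximable_square_integrable[OF g] unfolding trig_approximable_def by blast
      then obtain F c where F: "finite F" "(LINT x|?\<mu>. (cmod (g x - (\<Sum>n\<in>F. c n * fourier_char n x)))\<^sup>2) < \<epsilon>"
        by (auto simp: trig_polys_def)
      have "?I - sum ?a F \<le> (LINT x|?\<mu>. (cmod (g x - (\<Sum>n\<in>F. c n * fourier_char n x)))\<^sup>2)"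
        unfolding integral_cmod_diff_trig_poly[OF g F(1)] by (simp add: sum_nonneg)
      moreover have "sum ?a F \<le> (SUP F\<in>{F. F \<subseteq> UNIV \<and> finite F}. sum ?a F)"
        using F(1) bessel by (intro cSUP_upper bdd_aboveI2) auto
      ultimately show "?I \<le> (SUP F\<in>{F. F \<subseteq> UNIV \<and> finite F}. sum ?a F) + \<epsilon>"
        using F(2) by linarith
    qed
  qed
  with sup show ?thesis by simp
qed

section \<open>Integration over a union of translated cubes\<close>

lemma distr_lebesgue_translation:
  "distr lebesgue lebesgue (\<lambda>x. x + a) = (lebesgue :: 'a::euclidean_space measure)"
  and measurable_lebesgue_translation: "(\<lambda>x. x + a) \<in> lebesgue \<rightarrow>\<^sub>M (lebesgue :: 'a measure)"
proof -
  \<comment> \<open>The translation is an affine map with all scaling factors 1, so its Jacobian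
    factor is 1.\<close>
  have eq: "(\<lambda>x. a + (\<Sum>j\<in>Basis. ((\<lambda>_. 1) j * inner x j) *\<^sub>R j)) = (\<lambda>x::'a. x + a)"
    by (simp add: euclidean_representation add.commute fun_eq_iff)
  show "(\<lambda>x. x + a) \<in> lebesgue \<rightarrow>\<^sub>M (lebesgue :: 'a measure)"
    using lebesgue_affine_measurable[of "\<lambda>_. 1" a] unfolding eq by simp
  have "lebesgue = density (distr lebesgue lebesgue (\<lambda>x::'a. x + a)) (\<lambda>_. 1)"
    using lebesgue_affine_euclidean[of "\<lambda>_. 1" a] unfolding eq by simp
  then show "distr lebesgue lebesgue (\<lambda>x. x + a) = (lebesgue :: 'a measure)"
    by (simp add: density_1)
qed

lemma lebesgue_on_translation:
  fixes S :: "'a::euclidean_space set" and f :: "'a \<Rightarrow> 'b::{banach,second_countable_topology}"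
  assumes S: "S \<in> sets lebesgue" and f: "f \<in> borel_measurable (lebesgue_on ((\<lambda>x. x + a) ` S))"
  shows "(\<lambda>x. f (x + a)) \<in> borel_measurable (lebesgue_on S)"
    and "integrable (lebesgue_on ((\<lambda>x. x + a) ` S)) f \<longleftrightarrow> integrable (lebesgue_on S) (\<lambda>x. f (x + a))"
    and "(LINT x|lebesgue_on ((\<lambda>x. x + a) ` S). f x) = (LINT x|lebesgue_on S. f (x + a))"
proof -
  let ?S = "(\<lambda>x. x + a) ` S"
  have S': "?S \<in> sets lebesgue"
    using lebesgue_sets_translation[OF S, of a] by (simp add: add.commute[of _ a])
  show meas: "(\<lambda>x. f (x + a)) \<in> borel_measurable (lebesgue_on S)"
    by (rule measurable_compose[OF _ f], rule measurable_restrict_space3)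
       (auto intro: measurable_lebesgue_translation)
  have g: "(\<lambda>x. indicator ?S x *\<^sub>R f x) \<in> borel_measurable lebesgue"
    using f S' by (simp add: borel_measurable_restrict_space_iff)
  have ind: "indicator ?S (x + a) = (indicator S x :: real)" for x
    by (auto simp: indicator_def)
  have "integrable (lebesgue_on ?S) f \<longleftrightarrow> integrable (distr lebesgue lebesgue (\<lambda>x. x + a)) (\<lambda>x. indicator ?S x *\<^sub>R f x)"
    using S' by (simp add: integrable_restrict_space distr_lebesgue_translation)
  also have "\<dots> \<longleftrightarrow> integrable lebesgue (\<lambda>x. indicator ?S (x + a) *\<^sub>R f (x + a))"
    by (rule integrable_distr_eq[OF measurable_lebesgue_translation g])
  finally show "integrable (lebesgue_on ?S) f \<longleftrightarrow> integrable (lebesgue_on S) (\<lambda>x. f (x + a))"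
    using S by (simp add: ind integrable_restrict_space)
  have "(LINT x|lebesgue_on ?S. f x) = (LINT x|distr lebesgue lebesgue (\<lambda>x. x + a). indicator ?S x *\<^sub>R f x)"
    using S' by (simp add: integral_restrict_space distr_lebesgue_translation)
  also have "\<dots> = (LINT x|lebesgue. indicator ?S (x + a) *\<^sub>R f (x + a))"
    by (rule integral_distr[OF measurable_lebesgue_translation g])
  finally show "(LINT x|lebesgue_on ?S. f x) = (LINT x|lebesgue_on S. f (x + a))"
    using S by (simp add: ind integral_restrict_space)
qed

text \<open>In each coordinate the two shifts are integers less than 1 apart.\<close>

lemma unit_cube_translates_disjoint:
  assumes "x \<in> unit_cube" "y \<in> unit_cube" "x + vec_of_int m = y + vec_of_int (n :: int ^ 'd::finite)"
  shows "m = n"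
proof -
  have "vec_nth m i = vec_nth n i" for i
  proof -
    have "vec_nth x i + of_int (vec_nth m i) = vec_nth y i + of_int (vec_nth n i)"
      using arg_cong[OF assms(3), of "\<lambda>v. vec_nth v i"] by simp
    moreover have "- (1/2) \<le> vec_nth x i" "vec_nth x i < 1/2" "- (1/2) \<le> vec_nth y i" "vec_nth y i < 1/2"
      using assms(1,2) by (simp_all add: unit_cube_def)
    ultimately have "\<bar>of_int (vec_nth m i - vec_nth n i)\<bar> < (1::real)" by simp
    then show ?thesis by linarith
  qed
  then show ?thesis by (simp add: Finite_Cartesian_Product.vec_eq_iff)
qed

lemma integral_over_finite_disjoint_union:
  fixes f :: "'a \<Rightarrow> 'b::{banach,second_countable_topology}"
  assumes I: "finite I" and A: "\<And>i. i \<in> I \<Longrightarrow> A i \<in> sets M" and disj: "disjoint_family_on A I"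
    and f: "f \<in> borel_measurable (restrict_space M (\<Union>i\<in>I. A i))"
  shows "integrable (restrict_space M (\<Union>i\<in>I. A i)) f \<longleftrightarrow> (\<forall>i\<in>I. integrable (restrict_space M (A i)) f)"
    and "integrable (restrict_space M (\<Union>i\<in>I. A i)) f \<Longrightarrow>
      (LINT x|restrict_space M (\<Union>i\<in>I. A i). f x) = (\<Sum>i\<in>I. LINT x|restrict_space M (A i). f x)"
proof -
  let ?U = "\<Union>i\<in>I. A i"
  have U: "?U \<in> sets M" using I A by auto
  have r: "integrable (restrict_space M B) f \<longleftrightarrow> integrable M (\<lambda>x. indicator B x *\<^sub>R f x)"
    "(LINT x|restrict_space M B. f x) = (LINT x|M. indicator B x *\<^sub>R f x)" if "B \<in> sets M" for B
    using that by (simp_all add: integrable_restrict_space integral_restrict_space sets.Int_space_eq2)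
  have sum: "indicator ?U x *\<^sub>R f x = (\<Sum>i\<in>I. indicator (A i) x *\<^sub>R f x)" for x
    using I disj by (simp add: indicator_UN_disjoint scaleR_sum_left)
  have "integrable (restrict_space M (A i)) f" if "integrable (restrict_space M ?U) f" "i \<in> I" for i
  proof -
    have "integrable M (\<lambda>x. indicator (A i) x *\<^sub>R (indicator ?U x *\<^sub>R f x))"
      using that(1) unfolding r(1)[OF U] by (rule integrable_mult_indicator[OF A[OF that(2)]])
    also have "(\<lambda>x. indicator (A i) x *\<^sub>R (indicator ?U x *\<^sub>R f x)) = (\<lambda>x. indicator (A i) x *\<^sub>R f x)"
      using that(2) by (auto simp: indicator_def fun_eq_iff)
    finally show ?thesis using A that(2) by (simp add: r)
  qed
  moreover have "integrable (restrict_space M ?U) f" if "\<forall>i\<in>I. integrable (restrict_space M (A i)) f"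
    using that A U by (auto simp: r sum)
  ultimately show iff: "integrable (restrict_space M ?U) f \<longleftrightarrow> (\<forall>i\<in>I. integrable (restrict_space M (A i)) f)"
    by blast
  assume "integrable (restrict_space M ?U) f"
  then have "\<And>i. i \<in> I \<Longrightarrow> integrable M (\<lambda>x. indicator (A i) x *\<^sub>R f x)" 
    using iff A r(1) by blast
  then show "(LINT x|restrict_space M ?U. f x) = (\<Sum>i\<in>I. LINT x|restrict_space M (A i). f x)"
    using U A by (simp add: r sum)
qed

context
  fixes N :: nat and M :: "nat \<Rightarrow> int ^ 'd::finite"
begin

lemma translate_unit_cube_lebesgue:
  "(\<lambda>x. x + vec_of_int m) ` (unit_cube :: (real ^ 'd) set) \<in> sets lebesgue"
  using lebesgue_sets_translation[OF unit_cube_lebesgue, of "vec_of_int m"] by (simp add: add.commute[of _ "vec_of_int m"])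

lemma translate_unit_cube_lmeasurable:
  "(\<lambda>x. x + vec_of_int m) ` (unit_cube :: (real ^ 'd) set) \<in> lmeasurable"
  using measurable_translation[OF unit_cube_lmeasurable, of "vec_of_int m"] by (simp add: add.commute[of _ "vec_of_int m"])

lemma multi_cube_lmeasurable: "multi_cube N M \<in> lmeasurable"
  unfolding multi_cube_def by (intro fmeasurable.finite_UN translate_unit_cube_lmeasurable) auto

lemma finite_measure_multi_cube: "finite_measure (lebesgue_on (multi_cube N M))"
  by (rule finite_measure_lebesgue_on[OF multi_cube_lmeasurable])

lemma measurable_multi_cube_translate:
  fixes f :: "real ^ 'd \<Rightarrow> 'b::{banach,second_countable_topology}"
  assumes f: "f \<in> borel_measurable (lebesgue_on (multi_cube N M))" and p: "p \<in> {1..N}"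
  shows "(\<lambda>x. f (x + vec_of_int (M p))) \<in> borel_measurable (lebesgue_on unit_cube)"
proof (rule lebesgue_on_translation(1)[OF unit_cube_lebesgue])
  show "f \<in> borel_measurable (lebesgue_on ((\<lambda>x. x + vec_of_int (M p)) ` unit_cube))"
    by (rule measurable_restrict_mono[OF f]) (use p in \<open>auto simp: multi_cube_def\<close>)
qed

text \<open>Folding onto one cube: distinct shifts make the pieces disjoint, and each piece is
  translated back.\<close>

lemma 
  fixes f :: "real ^ 'd \<Rightarrow> 'b::{banach,second_countable_topology}"
  assumes inj: "inj_on M {1..N}" and f: "f \<in> borel_measurable (lebesgue_on (multi_cube N M))"
  shows integrable_multi_cube: "integrable (lebesgue_on (multi_cube N M)) f \<longleftrightarrow>
            (\<forall>p\<in>{1..N}. integrable (lebesgue_on unit_cube) (\<lambda>x. f (x + vec_of_int (M p))))" (is ?thesis1)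
    and integral_multi_cube: "integrable (lebesgue_on (multi_cube N M)) f \<Longrightarrow> (LINT x|lebesgue_on (multi_cube N M). f x) =
            (\<Sum>p\<in>{1..N}. LINT x|lebesgue_on unit_cube. f (x + vec_of_int (M p)))" (is "_ \<Longrightarrow> ?thesis2")
proof -
  let ?A = "\<lambda>p. (\<lambda>x. x + vec_of_int (M p)) ` unit_cube :: (real ^ 'd) set"
  have A: "\<And>i. i \<in> {1..N} \<Longrightarrow> ?A i \<in> sets lebesgue" by (rule translate_unit_cube_lebesgue)
  have disj: "disjoint_family_on ?A {1..N}"
  proof (unfold disjoint_family_on_def, intro ballI impI)
    fix p q assume pq: "p \<in> {1..N}" "q \<in> {1..N}" "p \<noteq> q"
    then have "M p \<noteq> M q" using inj by (auto simp: inj_on_eq_iff)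
    then show "?A p \<inter> ?A q = {}"
      using unit_cube_translates_disjoint[of _ _ "M p" "M q"] by auto
  qed
  have fA: "f \<in> borel_measurable (lebesgue_on (?A p))" if "p \<in> {1..N}" for p
    by (rule measurable_restrict_mono[OF f]) (use that in \<open>auto simp: multi_cube_def\<close>)
  note tr = lebesgue_on_translation[OF unit_cube_lebesgue fA]
  note un = integral_over_finite_disjoint_union[OF finite_atLeastAtMost A disj f[unfolded multi_cube_def]]
  have un1: "integrable (lebesgue_on (multi_cube N M)) f \<longleftrightarrow> (\<forall>p\<in>{1..N}. integrable (lebesgue_on (?A p)) f)"
    unfolding multi_cube_def by (rule un(1))
  show ?thesis1 unfolding un1 by (intro ball_cong tr(2) refl)
  assume "integrable (lebesgue_on (multi_cube N M)) f"
  then have "(LINT x|lebesgue_on (multi_cube N M). f x) = (\<Sum>p\<in>{1..N}. LINT x|lebesgue_on (?A p). f x)"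
    unfolding multi_cube_def by (intro un(2))
  also have "\<dots> = (\<Sum>p\<in>{1..N}. LINT x|lebesgue_on unit_cube. f (x + vec_of_int (M p)))"
    by (intro sum.cong tr(3) refl)
  finally show ?thesis2 .
qed

lemma square_integrable_multi_cube_translate:
  assumes inj: "inj_on M {1..N}" and f: "f \<in> square_integrable (lebesgue_on (multi_cube N M))" and p: "p \<in> {1..N}"
  shows "(\<lambda>x. f (x + vec_of_int (M p))) \<in> square_integrable (lebesgue_on unit_cube)"
proof -
  have m: "f \<in> borel_measurable (lebesgue_on (multi_cube N M))" using f by (rule square_integrable_measurable)
  have "(\<lambda>x. (cmod (f x))\<^sup>2) \<in> borel_measurable (lebesgue_on (multi_cube N M))"
    using m by measurable
  from integrable_multi_cube[OF inj this] square_integrable_integrable[OF f] p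
  show ?thesis using measurable_multi_cube_translate[OF m p]
    by (simp add: square_integrable_def)
qed

text \<open>Together with the inner product formula below, this treats functions on the union as
  vector-valued functions on the cube, with components w (x + M_p).\<close>

lemma L2_norm_multi_cube:
  assumes inj: "inj_on M {1..N}" and f: "f \<in> square_integrable (lebesgue_on (multi_cube N M))"
  shows "(L2_norm (lebesgue_on (multi_cube N M)) f)\<^sup>2 =
    (LINT x|lebesgue_on unit_cube. (\<Sum>p\<in>{1..N}. (cmod (f (x + vec_of_int (M p))))\<^sup>2))"
proof -
  have "(\<lambda>x. (cmod (f x))\<^sup>2) \<in> borel_measurable (lebesgue_on (multi_cube N M))"
    using square_integrable_measurable[OF f] by measurable
  from integral_multi_cube[OF inj this square_integrable_integrable[OF f]]
  show ?thesis
    using square_integrable_integrable[OF square_integrable_multi_cube_translate[OF inj f]]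
    by (simp add: L2_norm_def integral_nonneg_AE sum_nonneg)
qed

lemma L2_inner_multi_cube:
  assumes inj: "inj_on M {1..N}" and f: "f \<in> square_integrable (lebesgue_on (multi_cube N M))"
    and g: "g \<in> square_integrable (lebesgue_on (multi_cube N M))"
  shows "L2_inner (lebesgue_on (multi_cube N M)) f g =
    (LINT x|lebesgue_on unit_cube. (\<Sum>p\<in>{1..N}. f (x + vec_of_int (M p)) * cnj (g (x + vec_of_int (M p)))))"
proof -
  have i: "integrable (lebesgue_on (multi_cube N M)) (\<lambda>x. f x * cnj (g x))"
    by (rule integrable_mult_cnj[OF f g])
  have "(\<lambda>x. f x * cnj (g x)) \<in> borel_measurable (lebesgue_on (multi_cube N M))"
    using i by (rule borel_measurable_integrable)
  from integral_multi_cube[OF inj this i]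
  show ?thesis
    using integrable_mult_cnj[OF square_integrable_multi_cube_translate[OF inj f] square_integrable_multi_cube_translate[OF inj g]]
    by (simp add: L2_inner_def)
qed

end

section \<open>The frame operator of the exponential system\<close>

lemma has_sum_finite_Times:
  fixes f :: "'i \<times> 'k \<Rightarrow> 'a::topological_comm_monoid_add"
  assumes "finite I" "\<And>i. i \<in> I \<Longrightarrow> ((\<lambda>k. f (i, k)) has_sum g i) K"
  shows "(f has_sum (\<Sum>i\<in>I. g i)) (I \<times> K)"
  using assms
proof (induction I rule: finite_induct)
  case (insert i I)
  have "(f has_sum g i) (Pair i ` K)"
    using insert.prems[of i] by (subst has_sum_reindex) (auto simp: inj_on_def o_def)
  moreover have "(f has_sum (\<Sum>i\<in>I. g i)) (I \<times> K)"
    using insert by auto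
  ultimately have "(f has_sum (g i + (\<Sum>i\<in>I. g i))) (Pair i ` K \<union> I \<times> K)"
    using insert.hyps by (intro has_sum_Un_disjoint) auto
  moreover have "Pair i ` K \<union> I \<times> K = insert i I \<times> K" by auto
  ultimately show ?case using insert.hyps by simp
qed simp

lemma fourier_char_int: "fourier_char n (vec_of_int m) = 1"
proof -
  have "inner (vec_of_int n) (vec_of_int m) = of_int (\<Sum>i\<in>UNIV. vec_nth n i * vec_nth m i)"
    by (simp add: inner_vec_def)
  then show ?thesis
    unfolding fourier_char_def by (simp only: cis_multiple_2pi Ints_of_int)
qed

text \<open>The integer shift leaves the character unchanged, so the cube number p enters only
  through a power of its node. The condition on j reconciles the natural subtraction in the exponent
  with \<open>real j - 1\<close>.\<close>

lemma expo_family_translate: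
  assumes "j \<ge> 1"
  shows "expo_family \<delta> (j, n) (x + vec_of_int (M p))
    = cis (2 * pi * node_arg M \<delta> p) ^ (j - 1) * (cis (2 * pi * (real j - 1) * inner \<delta> x) * fourier_char n x)"
proof -
  have "expo_family \<delta> (j, n) (x + vec_of_int (M p))
      = cis (2 * pi * inner (vec_of_int n + (real j - 1) *\<^sub>R \<delta>) (x + vec_of_int (M p)))"
    by (simp add: expo_family_def cis_conv_exp mult_ac)
  also have "inner (vec_of_int n + (real j - 1) *\<^sub>R \<delta>) (x + vec_of_int (M p))
      = (real j - 1) * node_arg M \<delta> p + (real j - 1) * inner \<delta> x + inner (vec_of_int n) x + inner (vec_of_int n) (vec_of_int (M p))"
    by (simp add: inner_add_left inner_add_right node_arg_def algebra_simps)
  also have "cis (2 * pi * \<dots>) = cis (2 * pi * ((real j - 1) * node_arg M \<delta> p))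
      * (cis (2 * pi * (real j - 1) * inner \<delta> x) * (fourier_char n x * fourier_char n (vec_of_int (M p))))"
    by (simp add: fourier_char_def cis_mult algebra_simps)
  also have "cis (2 * pi * ((real j - 1) * node_arg M \<delta> p)) = cis (2 * pi * node_arg M \<delta> p) ^ (j - 1)"
    using assms by (simp add: Complex.DeMoivre of_nat_diff mult_ac)
  finally show ?thesis by (simp add: fourier_char_int)
qed

lemma expo_family_square_integrable:
  "expo_family \<delta> k \<in> square_integrable (lebesgue_on (multi_cube N (M :: nat \<Rightarrow> int ^ 'd::finite)))"
proof -
  obtain j n where k: "k = (j, n)" by (cases k)
  have eq: "expo_family \<delta> k = (\<lambda>x. cis (2 * pi * inner (vec_of_int n + (real j - 1) *\<^sub>R \<delta>) x))"
    by (simp add: k expo_family_def cis_conv_exp mult_ac fun_eq_iff)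
  have "continuous_on (multi_cube N M) (expo_family \<delta> k)"
    unfolding eq by (intro continuous_intros)
  then have "expo_family \<delta> k \<in> borel_measurable (lebesgue_on (multi_cube N M))"
    by (rule continuous_imp_measurable_on_sets_lebesgue) (use multi_cube_lmeasurable in blast)
  then show ?thesis
    by (rule square_integrable_bounded[OF finite_measure_multi_cube, of _ _ _ 1]) (simp add: eq)
qed

lemma cnj_cis_inner_measurable:
  "(\<lambda>x. cnj (cis (a * inner \<delta> x))) \<in> borel_measurable (lebesgue_on (unit_cube :: (real ^ 'd::finite) set))"
  by (intro continuous_on_measurable_unit_cube continuous_intros)

context
  fixes N :: nat and M :: "nat \<Rightarrow> int ^ 'd::finite" and \<delta> :: "real ^ 'd"
  assumes inj: "inj_on M {1..N}"
begin

abbreviation node :: "nat \<Rightarrow> complex" where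
  "node p \<equiv> cis (2 * pi * node_arg M \<delta> p)"

text \<open>Each layer j is a Fourier series on the cube; Parseval is applied to each of the N
  layers and the results are added.\<close>

lemma frame_sum_eq_integral:
  assumes w: "w \<in> square_integrable (lebesgue_on (multi_cube N M))"
  shows "((\<lambda>k. (cmod (L2_inner (lebesgue_on (multi_cube N M)) w (expo_family \<delta> k)))\<^sup>2)
      has_sum (LINT x|lebesgue_on unit_cube. vandermonde_form N node (\<lambda>p. w (x + vec_of_int (M p))))) (expo_index N)"
    and "integrable (lebesgue_on unit_cube) (\<lambda>x. vandermonde_form N node (\<lambda>p. w (x + vec_of_int (M p))))"
proof -
  let ?\<mu> = "lebesgue_on unit_cube :: (real ^ 'd) measure"
  let ?S = "\<lambda>j x. \<Sum>p=1..N. w (x + vec_of_int (M p)) * cnj (node p) ^ (j - 1)"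
  let ?e = "\<lambda>j x. cnj (cis (2 * pi * (real j - 1) * inner \<delta> x))"
  \<comment> \<open>The modulation by (j - 1) \<delta> is independent of p and n. It is moved from
    the exponential into the function, where it leaves the modulus unchanged.\<close>
  define G where "G j x = ?S j x * ?e j x" for j x
  have S: "?S j \<in> square_integrable ?\<mu>" for j
  proof (rule square_integrable_sum)
    fix p assume "p \<in> {1..N}"
    then show "(\<lambda>x. w (x + vec_of_int (M p)) * cnj (node p) ^ (j - 1)) \<in> square_integrable ?\<mu>"
      using square_integrable_cmult[OF square_integrable_multi_cube_translate[OF inj w], of p "cnj (node p) ^ (j - 1)"]
      by (simp add: mult.commute)
  qed
  have G: "G j \<in> square_integrable ?\<mu>" for j
    unfolding G_def by (rule square_integrable_mult_bounded[OF S cnj_cis_inner_measurable]) simp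
  have norm_G: "cmod (G j x) = cmod (?S j x)" for j x
    by (simp add: G_def norm_mult)
  have coeff: "L2_inner (lebesgue_on (multi_cube N M)) w (expo_family \<delta> (j, n)) = L2_inner ?\<mu> (G j) (fourier_char n)"
    if "j \<in> {1..N}" for j n
  proof -
    have "(\<Sum>p=1..N. w (x + vec_of_int (M p)) * cnj (expo_family \<delta> (j, n) (x + vec_of_int (M p))))
        = G j x * cnj (fourier_char n x)" for x
    proof -
      have "w (x + vec_of_int (M p)) * cnj (expo_family \<delta> (j, n) (x + vec_of_int (M p)))
          = w (x + vec_of_int (M p)) * cnj (node p) ^ (j - 1) * (?e j x * cnj (fourier_char n x))" for p
      proof -
        have "expo_family \<delta> (j, n) (x + vec_of_int (M p))
            = node p ^ (j - 1) * (cis (2 * pi * (real j - 1) * inner \<delta> x) * fourier_char n x)"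
          using that by (intro expo_family_translate) simp
        then show ?thesis by (simp only: complex_cnj_mult complex_cnj_power mult.assoc)
      qed
      then show ?thesis by (simp only: G_def sum_distrib_right mult.assoc)
    qed
    then show ?thesis
      unfolding L2_inner_multi_cube[OF inj w expo_family_square_integrable] by (simp only: L2_inner_def)
  qed
  have form: "vandermonde_form N node (\<lambda>p. w (x + vec_of_int (M p))) = (\<Sum>j=1..N. (cmod (G j x))\<^sup>2)" for x
    unfolding vandermonde_form_def norm_G ..
  have int: "integrable ?\<mu> (\<lambda>x. (cmod (G j x))\<^sup>2)" for j
    by (rule square_integrable_integrable[OF G])
  show "integrable ?\<mu> (\<lambda>x. vandermonde_form N node (\<lambda>p. w (x + vec_of_int (M p))))"
    unfolding form using int by simp
  have "((\<lambda>k. (cmod (L2_inner (lebesgue_on (multi_cube N M)) w (expo_family \<delta> k)))\<^sup>2)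
      has_sum (\<Sum>j=1..N. LINT x|?\<mu>. (cmod (G j x))\<^sup>2)) ({1..N} \<times> UNIV)"
  proof (rule has_sum_finite_Times)
    fix j assume j: "j \<in> {1..N}"
    show "((\<lambda>n. (cmod (L2_inner (lebesgue_on (multi_cube N M)) w (expo_family \<delta> (j, n))))\<^sup>2)
      has_sum (LINT x|?\<mu>. (cmod (G j x))\<^sup>2)) UNIV"
      unfolding coeff[OF j] by (rule fourier_parseval[OF G])
  qed simp
  also have "(\<Sum>j=1..N. LINT x|?\<mu>. (cmod (G j x))\<^sup>2) = (LINT x|?\<mu>. vandermonde_form N node (\<lambda>p. w (x + vec_of_int (M p))))"
    unfolding form using int by simp
  finally show "((\<lambda>k. (cmod (L2_inner (lebesgue_on (multi_cube N M)) w (expo_family \<delta> k)))\<^sup>2)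
      has_sum (LINT x|?\<mu>. vandermonde_form N node (\<lambda>p. w (x + vec_of_int (M p))))) (expo_index N)"
    unfolding expo_index_def .
qed

text \<open>The pointwise inequality for the vector of values w (x + M_p), integrated over
  x.\<close>

lemma frame_bounds_expo_family:
  assumes A: "A > 0" "\<And>u. A * (\<Sum>p=1..N. (cmod (u p))\<^sup>2) \<le> vandermonde_form N node u"
    and B: "B > 0" "\<And>u. vandermonde_form N node u \<le> B * (\<Sum>p=1..N. (cmod (u p))\<^sup>2)"
  shows "frame_bounds (lebesgue_on (multi_cube N M)) (expo_index N) (expo_family \<delta>) A B"
  unfolding frame_bounds_def
proof (intro conjI ballI A(1) B(1))
  fix w assume w: "w \<in> square_integrable (lebesgue_on (multi_cube N M))"
  let ?\<mu> = "lebesgue_on unit_cube :: (real ^ 'd) measure"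
  note hs = frame_sum_eq_integral[OF w]
  show "(\<lambda>k. (cmod (L2_inner (lebesgue_on (multi_cube N M)) w (expo_family \<delta> k)))\<^sup>2) summable_on expo_index N"
    using hs(1) by (rule has_sum_imp_summable)
  have int: "integrable ?\<mu> (\<lambda>x. \<Sum>p=1..N. (cmod (w (x + vec_of_int (M p))))\<^sup>2)"
    by (intro Bochner_Integration.integrable_sum square_integrable_integrable square_integrable_multi_cube_translate[OF inj w])
  show "A * (L2_norm (lebesgue_on (multi_cube N M)) w)\<^sup>2
      \<le> (\<Sum>\<^sub>\<infinity>k\<in>expo_index N. (cmod (L2_inner (lebesgue_on (multi_cube N M)) w (expo_family \<delta> k)))\<^sup>2)"
    unfolding infsumI[OF hs(1)] L2_norm_multi_cube[OF inj w] integral_mult_right_zero[symmetric]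
    by (intro integral_mono A(2) hs(2) integrable_mult_right int)
  show "(\<Sum>\<^sub>\<infinity>k\<in>expo_index N. (cmod (L2_inner (lebesgue_on (multi_cube N M)) w (expo_family \<delta> k)))\<^sup>2)
      \<le> B * (L2_norm (lebesgue_on (multi_cube N M)) w)\<^sup>2"
    unfolding infsumI[OF hs(1)] L2_norm_multi_cube[OF inj w] integral_mult_right_zero[symmetric]
    by (intro integral_mono B(2) hs(2) integrable_mult_right int)
qed

text \<open>The bounds are tested on functions that are constant on each of the translated cubes.\<close>

lemma frame_bounds_expo_family_necessary:
  assumes "frame_bounds (lebesgue_on (multi_cube N M)) (expo_index N) (expo_family \<delta>) A B"
  shows "A * (\<Sum>p=1..N. (cmod (u p))\<^sup>2) \<le> vandermonde_form N node u"
    and "vandermonde_form N node u \<le> B * (\<Sum>p=1..N. (cmod (u p))\<^sup>2)"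
proof -
  let ?\<mu> = "lebesgue_on unit_cube :: (real ^ 'd) measure"
  let ?A = "\<lambda>p. (\<lambda>x. x + vec_of_int (M p)) ` unit_cube :: (real ^ 'd) set"
  define w :: "real ^ 'd \<Rightarrow> complex" where "w y = (\<Sum>p=1..N. u p * indicator (?A p) y)" for y
  have "indicator (?A p) \<in> square_integrable (lebesgue_on (multi_cube N M))" if "p \<in> {1..N}" for p
  proof (rule square_integrable_bounded[OF finite_measure_multi_cube, where B = 1])
    have "?A p \<inter> multi_cube N M \<in> sets (lebesgue_on (multi_cube N M))"
      using translate_unit_cube_lebesgue[of "M p"] by (auto simp: sets_restrict_space)
    moreover have "?A p \<subseteq> multi_cube N M" using that by (auto simp: multi_cube_def)
    ultimately show "indicator (?A p) \<in> borel_measurable (lebesgue_on (multi_cube N M))"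
      by (simp add: Int_absorb2)
  qed (simp add: indicator_def)
  then have w: "w \<in> square_integrable (lebesgue_on (multi_cube N M))"
    unfolding w_def by (intro square_integrable_sum square_integrable_cmult)
  have wu: "w (x + vec_of_int (M q)) = u q" if "x \<in> unit_cube" "q \<in> {1..N}" for x q
  proof -
    have "x + vec_of_int (M q) \<in> ?A p \<longleftrightarrow> p = q" if "p \<in> {1..N}" for p
      using unit_cube_translates_disjoint[OF \<open>x \<in> unit_cube\<close>, of _ "M q" "M p"] \<open>x \<in> unit_cube\<close> inj that \<open>q \<in> {1..N}\<close>
      by (auto simp: inj_on_eq_iff)
    then have "w (x + vec_of_int (M q)) = (\<Sum>p=1..N. if p = q then u p else 0)"
      unfolding w_def by (intro sum.cong) (auto simp: indicator_def)
    then show ?thesis using that(2) by simp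
  qed
  \<comment> \<open>The cube has volume 1, read off from the character of frequency 0.\<close>
  have one: "(LINT x|?\<mu>. c) = c" for c :: real
  proof -
    have "complex_of_real (measure ?\<mu> unit_cube) = 1" using integral_fourier_char[of "0 :: int ^ 'd"] by (simp add: scaleR_conv_of_real)
    then show ?thesis by simp
  qed
  have "vandermonde_form N node (\<lambda>p. w (x + vec_of_int (M p))) = vandermonde_form N node u" if "x \<in> unit_cube" for x
    unfolding vandermonde_form_def using wu[OF that] by simp
  then have "(LINT x|?\<mu>. vandermonde_form N node (\<lambda>p. w (x + vec_of_int (M p)))) = (LINT x|?\<mu>. vandermonde_form N node u)"
    by (intro Bochner_Integration.integral_cong) auto
  then have 1: "(\<Sum>\<^sub>\<infinity>k\<in>expo_index N. (cmod (L2_inner (lebesgue_on (multi_cube N M)) w (expo_family \<delta> k)))\<^sup>2) = vandermonde_form N node u"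
    unfolding infsumI[OF frame_sum_eq_integral(1)[OF w]] one .
  have "(LINT x|?\<mu>. (\<Sum>p=1..N. (cmod (w (x + vec_of_int (M p))))\<^sup>2)) = (LINT x|?\<mu>. (\<Sum>p=1..N. (cmod (u p))\<^sup>2))"
    using wu by (intro Bochner_Integration.integral_cong) auto
  then have 2: "(L2_norm (lebesgue_on (multi_cube N M)) w)\<^sup>2 = (\<Sum>p=1..N. (cmod (u p))\<^sup>2)"
    unfolding L2_norm_multi_cube[OF inj w] one .
  show "A * (\<Sum>p=1..N. (cmod (u p))\<^sup>2) \<le> vandermonde_form N node u"
    and "vandermonde_form N node u \<le> B * (\<Sum>p=1..N. (cmod (u p))\<^sup>2)"
    using assms w unfolding frame_bounds_def 1[symmetric] 2[symmetric] by auto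
qed

lemma not_frame_expo_family:
  assumes pq: "p \<in> {1..N}" "q \<in> {1..N}" "p \<noteq> q" and "inner (vec_of_int (M p) - vec_of_int (M q)) \<delta> \<in> \<int>"
  shows "\<not> frame_bounds (lebesgue_on (multi_cube N M)) (expo_index N) (expo_family \<delta>) A B"
proof
  assume fb: "frame_bounds (lebesgue_on (multi_cube N M)) (expo_index N) (expo_family \<delta>) A B"
  have "node_arg M \<delta> p - node_arg M \<delta> q \<in> \<int>"
    using assms(4) by (simp add: node_arg_def inner_diff_right inner_commute[of _ \<delta>])
  then have "cis (2 * pi * (node_arg M \<delta> p - node_arg M \<delta> q)) = 1" by (rule cis_multiple_2pi)
  moreover have "cis (2 * pi * (node_arg M \<delta> p - node_arg M \<delta> q)) = node p / node q"
    by (simp add: cis_divide algebra_simps)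
  ultimately have nodes: "node p = node q" by simp
  \<comment> \<open>Coinciding nodes make the difference of the two unit vectors a zero of the form,
    while its squared norm is 2; the lower bound would give 2 A \<le> 0.\<close>
  define u :: "nat \<Rightarrow> complex" where "u = (\<lambda>_. 0)(p := 1, q := -1)"
  have u: "(\<Sum>i=1..N. f i (u i)) = f p 1 + f q (-1)" if "\<And>i. f i 0 = 0" for f :: "nat \<Rightarrow> complex \<Rightarrow> 'b::ab_group_add"
  proof -
    have "(\<Sum>i=1..N. f i (u i)) = (\<Sum>i\<in>{p, q}. f i (u i))"
      using pq that by (intro sum.mono_neutral_right) (auto simp: u_def)
    then show ?thesis using pq(3) by (simp add: u_def)
  qed
  have "(\<Sum>i=1..N. u i * cnj (node i) ^ (j - 1)) = 0" for j
    using u[of "\<lambda>i c. c * cnj (node i) ^ (j - 1)"] nodes by simp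
  then have "vandermonde_form N node u = 0" by (simp add: vandermonde_form_def)
  moreover have "(\<Sum>i=1..N. (cmod (u i))\<^sup>2) = 2"
    using u[of "\<lambda>i c. (cmod c)\<^sup>2"] by simp
  ultimately have "A * 2 \<le> 0"
    using frame_bounds_expo_family_necessary(1)[OF fb, of u] by simp
  then show False using fb by (simp add: frame_bounds_def)
qed

text \<open>At each x, the values of a finite combination on the N cubes are a Vandermonde matrix
  applied to the vector of its layers. The two-sided bound for that matrix is integrated, and
  orthonormality of the characters turns the layers into coefficient sums.\<close>

lemma is_riesz_sequence_expo_family:
  assumes nodes: "inj_on node {1..N}"
  shows "is_riesz_sequence (lebesgue_on (multi_cube N M)) (expo_index N) (expo_family \<delta>)"
proof -
  let ?\<mu> = "lebesgue_on unit_cube :: (real ^ 'd) measure"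
  obtain c C where c: "c > 0" and C: "C > 0"
    and lower: "\<And>g. c * (\<Sum>j=1..N. (cmod (g j))\<^sup>2) \<le> (\<Sum>p=1..N. (cmod (\<Sum>j=1..N. g j * node p ^ (j - 1)))\<^sup>2)"
    and upper: "\<And>g. (\<Sum>p=1..N. (cmod (\<Sum>j=1..N. g j * node p ^ (j - 1)))\<^sup>2) \<le> C * (\<Sum>j=1..N. (cmod (g j))\<^sup>2)"
    using vandermonde_bounds[OF nodes] by blast
  have main: "c * (\<Sum>k\<in>J. (cmod (a k))\<^sup>2) \<le> (L2_norm (lebesgue_on (multi_cube N M)) (\<lambda>x. \<Sum>k\<in>J. a k * expo_family \<delta> k x))\<^sup>2 \<and>
      (L2_norm (lebesgue_on (multi_cube N M)) (\<lambda>x. \<Sum>k\<in>J. a k * expo_family \<delta> k x))\<^sup>2 \<le> C * (\<Sum>k\<in>J. (cmod (a k))\<^sup>2)"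
    if J: "finite J" "J \<subseteq> expo_index N" for J a
  proof -
    define F where "F = snd ` J"
    \<comment> \<open>Extension by zero to the rectangle \<open>{1..N} \<times> F\<close>, so that
      sums over J split by layers.\<close>
    define b where "b k = (if k \<in> J then a k else 0)" for k
    have F: "finite F" using J(1) by (simp add: F_def)
    have JF: "J \<subseteq> {1..N} \<times> F" using J(2) by (force simp: F_def expo_index_def)
    have extend: "(\<Sum>k\<in>J. h k (a k)) = (\<Sum>j=1..N. \<Sum>n\<in>F. h (j, n) (b (j, n)))"
      if "\<And>k. h k 0 = 0" for h :: "nat \<times> (int ^ 'd) \<Rightarrow> complex \<Rightarrow> 'b::comm_monoid_add"
    proof -
      have "(\<Sum>k\<in>J. h k (a k)) = (\<Sum>k\<in>{1..N} \<times> F. h k (b k))"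
        using JF F that by (intro sum.mono_neutral_cong_left) (auto simp: b_def)
      then show ?thesis by (simp add: sum.cartesian_product)
    qed
    let ?f = "\<lambda>x. \<Sum>k\<in>J. a k * expo_family \<delta> k x"
    define P where "P j x = (\<Sum>n\<in>F. b (j, n) * fourier_char n x)" for j x
    \<comment> \<open>Layer j at x: a trigonometric polynomial times a unimodular modulation, which
      the squared moduli do not see.\<close>
    define g where "g j x = cis (2 * pi * (real j - 1) * inner \<delta> x) * P j x" for j x
    have f: "?f \<in> square_integrable (lebesgue_on (multi_cube N M))"
      by (intro square_integrable_sum square_integrable_cmult expo_family_square_integrable)
    have fg: "?f (x + vec_of_int (M p)) = (\<Sum>j=1..N. g j x * node p ^ (j - 1))" for x p
    proof -
      have "?f (x + vec_of_int (M p)) = (\<Sum>j=1..N. \<Sum>n\<in>F. b (j, n) * expo_family \<delta> (j, n) (x + vec_of_int (M p)))"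
        by (rule extend[of "\<lambda>k c. c * expo_family \<delta> k (x + vec_of_int (M p))"]) simp
      also have "\<dots> = (\<Sum>j=1..N. g j x * node p ^ (j - 1))"
        by (intro sum.cong refl) (simp add: expo_family_translate g_def P_def sum_distrib_left sum_distrib_right mult_ac)
      finally show ?thesis .
    qed
    have norm_g: "cmod (g j x) = cmod (P j x)" for j x by (simp add: g_def norm_mult)
    have P: "P j \<in> square_integrable ?\<mu>" for j
      unfolding P_def by (intro square_integrable_sum square_integrable_cmult fourier_char_square_integrable)
    have int_g: "integrable ?\<mu> (\<lambda>x. \<Sum>j=1..N. (cmod (g j x))\<^sup>2)"
      unfolding norm_g by (intro Bochner_Integration.integrable_sum square_integrable_integrable P)
    have "(LINT x|?\<mu>. (\<Sum>j=1..N. (cmod (g j x))\<^sup>2)) = (\<Sum>j=1..N. LINT x|?\<mu>. (cmod (P j x))\<^sup>2)"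
      unfolding norm_g by (intro Bochner_Integration.integral_sum square_integrable_integrable P)
    also have "\<dots> = (\<Sum>j=1..N. \<Sum>n\<in>F. (cmod (b (j, n)))\<^sup>2)"
      unfolding P_def integral_cmod_trig_poly[OF F] ..
    also have "\<dots> = (\<Sum>k\<in>J. (cmod (a k))\<^sup>2)"
      by (rule extend[of "\<lambda>k c. (cmod c)\<^sup>2", symmetric]) simp
    finally have sum_g: "(LINT x|?\<mu>. (\<Sum>j=1..N. (cmod (g j x))\<^sup>2)) = (\<Sum>k\<in>J. (cmod (a k))\<^sup>2)" .
    have norm_f: "(L2_norm (lebesgue_on (multi_cube N M)) ?f)\<^sup>2
        = (LINT x|?\<mu>. (\<Sum>p=1..N. (cmod (\<Sum>j=1..N. g j x * node p ^ (j - 1)))\<^sup>2))"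
      unfolding L2_norm_multi_cube[OF inj f] fg ..
    have int_f: "integrable ?\<mu> (\<lambda>x. \<Sum>p=1..N. (cmod (\<Sum>j=1..N. g j x * node p ^ (j - 1)))\<^sup>2)"
      unfolding fg[symmetric]
      by (intro Bochner_Integration.integrable_sum square_integrable_integrable square_integrable_multi_cube_translate[OF inj f])
    show ?thesis
      unfolding norm_f sum_g[symmetric] integral_mult_right_zero[symmetric]
      by (intro conjI integral_mono int_f integrable_mult_right int_g lower upper)
  qed
  have "countable (UNIV :: (int ^ 'd) set)"
    by (rule countableI_type)
  then have count: "countable (expo_index N :: (nat \<times> (int ^ 'd)) set)" unfolding expo_index_def by simp
  have bounds: "\<forall>J a. finite J \<and> J \<subseteq> expo_index N \<longrightarrow>
      c * (\<Sum>k\<in>J. (cmod (a k))\<^sup>2) \<le> (L2_norm (lebesgue_on (multi_cube N M)) (\<lambda>x. \<Sum>k\<in>J. a k * expo_family \<delta> k x))\<^sup>2 \<and>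
      (L2_norm (lebesgue_on (multi_cube N M)) (\<lambda>x. \<Sum>k\<in>J. a k * expo_family \<delta> k x))\<^sup>2 \<le> C * (\<Sum>k\<in>J. (cmod (a k))\<^sup>2)"
    by (intro allI impI, elim conjE) (rule main)
  show ?thesis
    unfolding is_riesz_sequence_def
    by (intro conjI ballI exI[of _ c] exI[of _ C] count c C bounds expo_family_square_integrable)
qed

end

section \<open>The criterion and the optimal constants\<close>

theorem theorem1p4:
  fixes N :: nat and M :: "nat \<Rightarrow> int ^ 'd::finite" and \<delta> :: "real ^ 'd"
  assumes "N \<ge> 1" and "inj_on M {1..N}"
  shows "(is_riesz_basis (lebesgue_on (multi_cube N M)) (expo_index N) (expo_family \<delta>) \<longleftrightarrow>
            (\<forall>p\<in>{1..N}. \<forall>q\<in>{1..N}. p \<noteq> q \<longrightarrow>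
               inner (vec_of_int (M p) - vec_of_int (M q)) \<delta> \<notin> \<int>))
       \<and> (is_riesz_basis (lebesgue_on (multi_cube N M)) (expo_index N) (expo_family \<delta>) \<longrightarrow>
            optimal_frame_constants (lebesgue_on (multi_cube N M)) (expo_index N) (expo_family \<delta>)
              (Min (spectrum (B_tilde N M \<delta>))) (Max (spectrum (B_tilde N M \<delta>))))"
    (is "(?basis \<longleftrightarrow> ?nonint) \<and> (?basis \<longrightarrow> ?opt)")
proof -
  \<comment> \<open>An integer difference already destroys the lower frame bound.\<close>
  have nonint: ?nonint if ?basis
    using that not_frame_expo_family[OF assms(2)]
    unfolding is_riesz_basis_def is_frame_def by blast
  have conv: "?basis \<and> ?opt" if ?nonint
  proof -
    let ?l = "Min (spectrum (B_tilde N M \<delta>))" and ?L = "Max (spectrum (B_tilde N M \<delta>))"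
    let ?fb = "frame_bounds (lebesgue_on (multi_cube N M)) (expo_index N) (expo_family \<delta>)"
    have ni: "\<And>p q. p \<in> {1..N} \<Longrightarrow> q \<in> {1..N} \<Longrightarrow> p \<noteq> q \<Longrightarrow>
      inner (vec_of_int (M p) - vec_of_int (M q)) \<delta> \<notin> \<int>" using that by blast
    have N: "N > 0" using assms(1) by simp
    have spec: "?l \<in> spectrum (B_tilde N M \<delta>)" "?L \<in> spectrum (B_tilde N M \<delta>)"
      using symmetric_mat_Min_spectrum(1)[OF B_tilde_carrier N B_tilde_sym]
        symmetric_mat_Max_spectrum(1)[OF B_tilde_carrier N B_tilde_sym] by auto
    have l: "?l > 0" by (rule Min_spectrum_B_tilde_pos[OF ni assms(1)])
    have "?l \<le> ?L" using spec(1) card_finite_spectrum(1)[OF B_tilde_carrier] by (intro Max_ge)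
    with l have L: "?L > 0" by simp
    have fb: "?fb ?l ?L"
      by (rule frame_bounds_expo_family[OF assms(2) l vandermonde_form_lower[OF ni assms(1)]
            L vandermonde_form_upper[OF ni assms(1)]])
    have rs: "is_riesz_sequence (lebesgue_on (multi_cube N M)) (expo_index N) (expo_family \<delta>)"
      by (rule is_riesz_sequence_expo_family[OF assms(2) inj_on_nodes[OF ni]])
    \<comment> \<open>Any frame bounds also bound the form on constant vectors; vectors where it
      attains the extremal eigenvalues give both comparisons.\<close>
    have opt: "A' \<le> ?l \<and> ?L \<le> B'" if fb': "?fb A' B'" for A' B'
    proof
      note nec = frame_bounds_expo_family_necessary[OF assms(2) fb']
      obtain u where u: "(\<Sum>p=1..N. (cmod (u p))\<^sup>2) > 0"
        "vandermonde_form N (\<lambda>p. cis (2 * pi * node_arg M \<delta> p)) u = ?l * (\<Sum>p=1..N. (cmod (u p))\<^sup>2)"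
        using vandermonde_form_eigenvalue[OF ni spec(1)] by blast
      show "A' \<le> ?l" using nec(1)[of u] u by simp
      obtain v where v: "(\<Sum>p=1..N. (cmod (v p))\<^sup>2) > 0"
        "vandermonde_form N (\<lambda>p. cis (2 * pi * node_arg M \<delta> p)) v = ?L * (\<Sum>p=1..N. (cmod (v p))\<^sup>2)"
        using vandermonde_form_eigenvalue[OF ni spec(2)] by blast
      show "?L \<le> B'" using nec(2)[of v] v by simp
    qed
    have ?basis
      unfolding is_riesz_basis_def is_frame_def using fb rs unfolding is_riesz_sequence_def by blast
    moreover have ?opt
      unfolding optimal_frame_constants_def using fb opt by blast
    ultimately show ?thesis ..
  qed
  from nonint conv show ?thesis by blast
qed

end
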